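(* Let $F$ be a Minkowski norm on $\mathbb{R}^2$ whose convex body $B=\{F\le 1\}$ is axisymmetric, i.e. invariant under the orthogonal reflection in some line through the origin. Then there exist a 1-form $\beta$ on $\mathbb{R}^2$ and a smooth positive function $\phi$ of one variable such that $T_{\beta,\phi}(F)=\alpha$, where $\alpha$ is the Euclidean norm on $\mathbb{R}^2$; that is, $B$ is moved to the unit disc by a $T_{\beta,\phi}$-deformation.
   Context: A Minkowski norm on $\mathbb{R}^n$ ($n>1$) is a function $F:\mathbb{R}^n\to[0,\infty)$ that is $C^\infty$ on $\mathbb{R}^n\setminus\{0\}$, satisfies $F(\lambda y)=\lambda F(y)$ for $\lambda>0$, and such that for every $y\ne 0$ the symmetric bilinear form $g_y(u,v)=\frac12\frac{\partial^2}{\partial s\,\partial t}[F^2(y+su+tv)]_{|s=t=0}$ is positive definite. 1-forms on $\mathbb{R}^n$ are linear functionals. For a Minkowski norm $F$, a 1-form $\beta$ has norm $F(\beta)=\sup_{y\neq 0}|\beta(y)|/F(y)$. Given a nonzero 1-form $\beta$ and a smooth function $\phi:[-\delta,\delta]\to(0,\infty)$ with $F(\beta)<\delta$, the $T_{\beta,\phi}$-deformation of $F$ (or of the convex body $\{F\le1\}$) is $T_{\beta,\phi}(F)=F\cdot\phi(\beta/F)$. Standing assumption on deformations: $\phi(s)-s\,\phi'(s)>0$. *)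

theory Defs
  imports "HOL-Analysis.Analysis"
begin

(* The derivatives are taken within S, so that the definition covers both open sets and closed
   intervals of the real line of positive length (one-sided derivatives at the endpoints).
   On such sets derivatives within S are unique; it is not meant for other sets. *)
primrec k_smooth_on :: "nat \<Rightarrow> 'a::real_normed_vector set \<Rightarrow> ('a \<Rightarrow> real) \<Rightarrow> bool" where
  "k_smooth_on 0 S f \<longleftrightarrow> continuous_on S f"
| "k_smooth_on (Suc k) S f \<longleftrightarrow>
     f differentiable_on S \<and>
     (\<forall>v. k_smooth_on k S (\<lambda>x. frechet_derivative f (at x within S) v))"

definition smooth_on :: "'a::real_normed_vector set \<Rightarrow> ('a \<Rightarrow> real) \<Rightarrow> bool" where
  "smooth_on S f \<longleftrightarrow> (\<forall>k. k_smooth_on k S f)"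

definition fundamental_form ::
  "(real^'n::finite \<Rightarrow> real) \<Rightarrow> real^'n \<Rightarrow> real^'n \<Rightarrow> real^'n \<Rightarrow> real" where
  "fundamental_form F y u v =
     1/2 * deriv (\<lambda>s. deriv (\<lambda>t. (F (y + s *\<^sub>R u + t *\<^sub>R v))\<^sup>2) 0) 0"

definition minkowski_norm :: "(real^'n::finite \<Rightarrow> real) \<Rightarrow> bool" where
  "minkowski_norm F \<longleftrightarrow>
     CARD('n) > 1 \<and>
     (\<forall>y. F y \<ge> 0) \<and>
     smooth_on (- {0}) F \<and>
     (\<forall>l y. l > 0 \<longrightarrow> F (l *\<^sub>R y) = l * F y) \<and>
     (\<forall>y u. y \<noteq> 0 \<longrightarrow> u \<noteq> 0 \<longrightarrow> fundamental_form F y u u > 0)"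

definition convex_body :: "(real^'n::finite \<Rightarrow> real) \<Rightarrow> (real^'n) set" where
  "convex_body F = {y. F y \<le> 1}"

definition reflection_in_line :: "real^'n::finite \<Rightarrow> real^'n \<Rightarrow> real^'n" where
  "reflection_in_line e y = (2 * ((y \<bullet> e) / (e \<bullet> e))) *\<^sub>R e - y"

definition axisymmetric :: "(real^2) set \<Rightarrow> bool" where
  "axisymmetric B \<longleftrightarrow> (\<exists>e. e \<noteq> 0 \<and> reflection_in_line e ` B = B)"

(* For a Minkowski norm F and a linear b the supremum is over a nonempty bounded set. *)
definition form_norm :: "(real^'n::finite \<Rightarrow> real) \<Rightarrow> (real^'n \<Rightarrow> real) \<Rightarrow> real" where
  "form_norm F b = (SUP y\<in>- {0}. \<bar>b y\<bar> / F y)"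

definition deformation_data ::
  "(real^'n::finite \<Rightarrow> real) \<Rightarrow> (real^'n \<Rightarrow> real) \<Rightarrow> real \<Rightarrow> (real \<Rightarrow> real) \<Rightarrow> bool" where
  "deformation_data F b d \<phi> \<longleftrightarrow>
     linear b \<and> b \<noteq> (\<lambda>y. 0) \<and> form_norm F b < d \<and>
     smooth_on {-d..d} \<phi> \<and>
     (\<forall>s\<in>{-d..d}. \<phi> s > 0) \<and>
     (\<forall>s\<in>{-d..d}. \<phi> s - s * vector_derivative \<phi> (at s within {-d..d}) > 0)"

(* At y = 0 we have F y = 0, so the value is 0 whatever b y / F y denotes there. *)
definition deform ::
  "(real^'n::finite \<Rightarrow> real) \<Rightarrow> (real \<Rightarrow> real) \<Rightarrow> (real^'n \<Rightarrow> real) \<Rightarrow> real^'n \<Rightarrow> real" where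
  "deform b \<phi> F y = F y * \<phi> (b y / F y)"

end

theory Submission
  imports Defs
begin

text \<open>Let \<open>e\<close> be a unit vector on the axis, \<open>\<beta> y = y \<bullet> e\<close> and let \<open>\<theta>\<close> be the angle
  measured from \<open>e\<close>. Since \<open>F\<close> does not see the sign of the coordinate normal to the axis, the values
  of \<open>F\<close> on the unit circle depend on \<open>x = cos \<theta>\<close> only, so \<open>F y = \<bar>y\<bar> * g (\<beta> y / \<bar>y\<bar>)\<close>: the norm \<open>F\<close>
  is itself a deformation of the Euclidean norm, and the task is to invert this deformation. With
  \<open>h x = x / g x\<close> we have \<open>\<beta> / F = h (\<beta> / \<bar>y\<bar>)\<close>, so if \<open>X\<close> is the inverse of \<open>h\<close>, then
  \<open>\<phi> s = s / X s\<close> satisfies \<open>F * \<phi> (\<beta> / F) = \<bar>y\<bar>\<close>. Three points need an argument.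

  Smoothness of \<open>g\<close> up to the endpoints of \<open>[-1, 1]\<close> is Whitney's theorem on even functions, with
  \<open>cos \<theta>\<close> in place of \<open>\<theta>\<^sup>2\<close>: a function \<open>f\<close> even about \<open>0\<close> and \<open>\<pi>\<close> has \<open>f' = - sin * n\<close> with \<open>n\<close>
  smooth and again even about both points, and \<open>n \<circ> arccos\<close> is the derivative of \<open>f \<circ> arccos\<close>
  (\<open>doubly_even_deriv\<close>, based on the Hadamard quotient \<open>hadamard_quotient\<close>).

  Invertibility of \<open>h\<close> means \<open>g - x * g' > 0\<close>. Up to the factor \<open>sin \<theta>\<close> this is the derivative of
  \<open>F\<close> in the direction normal to the axis. Along each line normal to the axis \<open>F\<^sup>2\<close> is even
  and strongly convex, so this derivative is positive off the axis
  (\<open>partial_normal_pos\<close>), and at the endpoints its positive second derivative takes over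
  (\<open>profile_function\<close>).

  Finally \<open>X\<close> is only given on the range of \<open>\<beta> / F\<close>, whereas \<open>\<phi>\<close> is wanted on a larger symmetric
  interval. In terms of \<open>X\<close> the requirements \<open>\<phi> > 0\<close> and \<open>\<phi> - s * \<phi>' > 0\<close> both reduce to \<open>X' > 0\<close>. Hence
  it suffices to extend \<open>ln X'\<close> smoothly, without any sign condition, which is Borel's theorem on
  prescribed Taylor coefficients (\<open>borel_one_sided\<close>, \<open>smooth_extend\<close>), and to integrate its exponential
  (\<open>deformation_function_exists\<close>).\<close>

section \<open>Smooth functions of one real variable\<close>

definition deriv_on :: "real set \<Rightarrow> (real \<Rightarrow> real) \<Rightarrow> (real \<Rightarrow> real) \<Rightarrow> bool" where
  "deriv_on S f f' \<longleftrightarrow> (\<forall>x\<in>S. (f has_real_derivative f' x) (at x within S))"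

text \<open>A smooth function is recorded together with a whole sequence of successive derivatives within
  \<open>S\<close>. This makes sense on closed intervals, where derivatives at the endpoints are
  one-sided, and avoids any appeal to uniqueness of derivatives.\<close>
definition tower_on :: "real set \<Rightarrow> (nat \<Rightarrow> real \<Rightarrow> real) \<Rightarrow> bool" where
  "tower_on S D \<longleftrightarrow> (\<forall>k. deriv_on S (D k) (D (Suc k)))"

definition smooth :: "real set \<Rightarrow> (real \<Rightarrow> real) \<Rightarrow> bool" where
  "smooth S f \<longleftrightarrow> (\<exists>D. tower_on S D \<and> D 0 = f)"

lemma deriv_onD: "deriv_on S f f' \<Longrightarrow> x \<in> S \<Longrightarrow> (f has_real_derivative f' x) (at x within S)"
  by (simp add: deriv_on_def)

lemma deriv_on_openD:
  "deriv_on S f f' \<Longrightarrow> open S \<Longrightarrow> x \<in> S \<Longrightarrow> (f has_real_derivative f' x) (at x)"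
  by (metis at_within_open deriv_onD)

lemma deriv_on_cong:
  assumes "\<And>x. x \<in> S \<Longrightarrow> f x = g x" "\<And>x. x \<in> S \<Longrightarrow> f' x = g' x"
  shows "deriv_on S f f' \<longleftrightarrow> deriv_on S g g'"
proof -
  have "(f has_real_derivative f' x) (at x within S) \<longleftrightarrow> (g has_real_derivative g' x) (at x within S)"
    if "x \<in> S" for x
    using assms that
    by (intro has_field_derivative_cong_ev) (auto simp: eventually_at_topological)
  then show ?thesis by (auto simp: deriv_on_def)
qed

lemma deriv_on_subset: "deriv_on S f f' \<Longrightarrow> T \<subseteq> S \<Longrightarrow> deriv_on T f f'"
  unfolding deriv_on_def by (meson DERIV_subset subset_iff)

lemma deriv_on_continuous_on: "deriv_on S f f' \<Longrightarrow> continuous_on S f"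
  by (meson DERIV_continuous_on deriv_onD)

lemma deriv_on_unique_const:
  assumes "convex S" "deriv_on S f f'" "deriv_on S g f'" "c \<in> S" "f c = g c" "x \<in> S"
  shows "f x = g x"
proof -
  have "((\<lambda>x. f x - g x) has_derivative (\<lambda>h. 0)) (at y within S)" if "y \<in> S" for y
  proof -
    have "((\<lambda>x. f x - g x) has_real_derivative f' y - f' y) (at y within S)"
      using assms that by (intro DERIV_diff) (auto dest: deriv_onD)
    then show ?thesis by (simp add: has_field_derivative_def lambda_zero)
  qed
  then obtain k where k: "\<And>y. y \<in> S \<Longrightarrow> f y - g y = k"
    using has_derivative_zero_constant[OF assms(1), of "\<lambda>x. f x - g x"] by blast
  then show ?thesis using k[OF \<open>c \<in> S\<close>] k[OF \<open>x \<in> S\<close>] assms(5) by simp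
qed

lemma smooth_step: "deriv_on S f f' \<Longrightarrow> smooth S f' \<Longrightarrow> smooth S f"
proof -
  assume "deriv_on S f f'" "smooth S f'"
  then obtain D where D: "tower_on S D" "D 0 = f'" by (auto simp: smooth_def)
  define E where "E k = (case k of 0 \<Rightarrow> f | Suc j \<Rightarrow> D j)" for k
  have "tower_on S E"
    unfolding tower_on_def
  proof
    fix k show "deriv_on S (E k) (E (Suc k))"
      using D \<open>deriv_on S f f'\<close> by (cases k) (auto simp: E_def tower_on_def)
  qed
  then show ?thesis unfolding smooth_def by (intro exI[of _ E]) (simp add: E_def)
qed

lemma smooth_deriv:
  assumes "smooth S f"
  obtains f' where "deriv_on S f f'" "smooth S f'"
proof -
  from assms obtain D where D: "tower_on S D" "D 0 = f" by (auto simp: smooth_def)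
  have "tower_on S (\<lambda>k. D (Suc k))" using D by (auto simp: tower_on_def)
  then have "smooth S (D 1)" unfolding smooth_def by (intro exI[of _ "\<lambda>k. D (Suc k)"]) auto
  with D show thesis by (intro that[of "D 1"]) (auto simp: tower_on_def)
qed

lemma smooth_cong: "smooth S f \<Longrightarrow> (\<And>x. x \<in> S \<Longrightarrow> f x = g x) \<Longrightarrow> smooth S g"
  by (metis deriv_on_cong smooth_deriv smooth_step)

lemma smooth_subset: "smooth S f \<Longrightarrow> T \<subseteq> S \<Longrightarrow> smooth T f"
  unfolding smooth_def tower_on_def by (metis deriv_on_subset)

lemma smooth_continuous_on: "smooth S f \<Longrightarrow> continuous_on S f"
  by (meson deriv_on_continuous_on smooth_deriv)

text \<open>Smoothness is the greatest fixed point of ``has a derivative of the same kind'', so it can be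
  proved by exhibiting a class of functions closed under taking derivatives.\<close>
lemma smooth_coinduct:
  assumes "P f" and step: "\<And>f. P f \<Longrightarrow> \<exists>f'. P f' \<and> deriv_on S f f'"
  shows "smooth S f"
proof -
  have "\<exists>D. \<forall>k. (P (D k) \<and> (k = 0 \<longrightarrow> D k = f)) \<and> deriv_on S (D k) (D (Suc k))"
  proof (rule dependent_nat_choice)
    show "\<exists>g. P g \<and> (0 = (0::nat) \<longrightarrow> g = f)" using assms by auto
  next
    fix g and n :: nat assume "P g \<and> (n = 0 \<longrightarrow> g = f)"
    then show "\<exists>h. (P h \<and> (Suc n = 0 \<longrightarrow> h = f)) \<and> deriv_on S g h" using step by auto
  qed
  then show ?thesis unfolding smooth_def tower_on_def by metis
qed

text \<open>Derivatives usually leave a class \<open>P\<close> but stay in the algebra that \<open>P\<close> generates over the smooth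
  functions. By the sum and product rules this algebra is then closed under derivatives, which turns
  coinduction into coinduction up to sums and products.\<close>
inductive algebra_over :: "real set \<Rightarrow> ((real \<Rightarrow> real) \<Rightarrow> bool) \<Rightarrow> (real \<Rightarrow> real) \<Rightarrow> bool"
  for S P where
  generator: "P f \<Longrightarrow> algebra_over S P f"
| smooth: "smooth S f \<Longrightarrow> algebra_over S P f"
| add: "algebra_over S P f \<Longrightarrow> algebra_over S P g \<Longrightarrow> algebra_over S P (\<lambda>x. f x + g x)"
| mult: "algebra_over S P f \<Longrightarrow> algebra_over S P g \<Longrightarrow> algebra_over S P (\<lambda>x. f x * g x)"

lemma algebra_over_deriv:
  assumes "algebra_over S P g"
    and step: "\<And>f. P f \<Longrightarrow> \<exists>f'. algebra_over S P f' \<and> deriv_on S f f'"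
  shows "\<exists>g'. algebra_over S P g' \<and> deriv_on S g g'"
  using assms(1)
proof induction
  case (generator f) then show ?case by (rule step)
next
  case (smooth f) then show ?case by (meson algebra_over.smooth smooth_deriv)
next
  case (add f g)
  then obtain f' g' where "algebra_over S P f'" "algebra_over S P g'" "deriv_on S f f'" "deriv_on S g g'"
    by auto
  then show ?case
    by (intro exI[of _ "\<lambda>x. f' x + g' x"])
      (auto intro!: algebra_over.add DERIV_add simp: deriv_on_def)
next
  case (mult f g)
  then obtain f' g' where *: "algebra_over S P f'" "algebra_over S P g'" "deriv_on S f f'" "deriv_on S g g'"
    by auto
  have "algebra_over S P (\<lambda>x. f' x * g x + g' x * f x)"
    using * mult by (intro algebra_over.add algebra_over.mult)
  moreover have "deriv_on S (\<lambda>x. f x * g x) (\<lambda>x. f' x * g x + g' x * f x)"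
    using * by (auto intro!: DERIV_mult simp: deriv_on_def)
  ultimately show ?case by blast
qed

lemma smooth_upto_algebra:
  assumes "P f" and step: "\<And>f. P f \<Longrightarrow> \<exists>f'. algebra_over S P f' \<and> deriv_on S f f'"
  shows "smooth S f"
  by (rule smooth_coinduct[of "algebra_over S P"])
    (use assms in \<open>auto intro: algebra_over.generator algebra_over_deriv\<close>)

lemma smooth_algebra: "algebra_over S (smooth S) f \<Longrightarrow> smooth S f"
  by (erule smooth_coinduct, erule algebra_over_deriv) (meson algebra_over.smooth smooth_deriv)

lemma smooth_add: "smooth S f \<Longrightarrow> smooth S g \<Longrightarrow> smooth S (\<lambda>x. f x + g x)"
  by (intro smooth_algebra algebra_over.add) (auto intro: algebra_over.smooth)

lemma smooth_mult: "smooth S f \<Longrightarrow> smooth S g \<Longrightarrow> smooth S (\<lambda>x. f x * g x)"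
  by (intro smooth_algebra algebra_over.mult) (auto intro: algebra_over.smooth)

lemma smooth_const: "smooth S (\<lambda>x. c)"
  by (rule smooth_coinduct[of "\<lambda>f. \<exists>c. f = (\<lambda>x. c)"])
    (auto simp: deriv_on_def intro!: exI[of _ "\<lambda>x. 0"])

lemma smooth_id: "smooth S (\<lambda>x. x)"
  by (rule smooth_step[OF _ smooth_const[of _ 1]]) (auto simp: deriv_on_def)

lemma smooth_minus: "smooth S f \<Longrightarrow> smooth S (\<lambda>x. - f x)"
  using smooth_mult[OF smooth_const[of S "-1"]] by simp

lemma smooth_diff: "smooth S f \<Longrightarrow> smooth S g \<Longrightarrow> smooth S (\<lambda>x. f x - g x)"
  using smooth_add[OF _ smooth_minus] by simp

lemma smooth_inverse:
  assumes "smooth S f" "\<And>x. x \<in> S \<Longrightarrow> f x \<noteq> 0"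
  shows "smooth S (\<lambda>x. inverse (f x))"
proof (rule smooth_upto_algebra[of "\<lambda>g. g = (\<lambda>x. inverse (f x))"])
  from assms obtain f' where f': "deriv_on S f f'" "smooth S f'" by (auto elim: smooth_deriv)
  let ?i = "\<lambda>x. inverse (f x)"
  have "algebra_over S (\<lambda>g. g = ?i) (\<lambda>x. - f' x * (?i x * ?i x))"
    using smooth_minus[OF f'(2)]
    by (intro algebra_over.mult) (auto intro: algebra_over.generator algebra_over.smooth)
  moreover have "deriv_on S ?i (\<lambda>x. - f' x * (?i x * ?i x))"
    using f' assms(2) by (auto simp: deriv_on_def intro!: derivative_eq_intros)
  ultimately show "\<exists>g'. algebra_over S (\<lambda>g. g = ?i) g' \<and> deriv_on S g g'" if "g = ?i" for g
    using that by blast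
qed simp

lemma smooth_divide:
  "smooth S f \<Longrightarrow> smooth S g \<Longrightarrow> (\<And>x. x \<in> S \<Longrightarrow> g x \<noteq> 0) \<Longrightarrow> smooth S (\<lambda>x. f x / g x)"
  using smooth_mult[OF _ smooth_inverse] by (simp add: divide_inverse)

lemma deriv_on_compose:
  assumes "deriv_on T g g'" "deriv_on S f f'" "f ` S \<subseteq> T"
  shows "deriv_on S (\<lambda>x. g (f x)) (\<lambda>x. g' (f x) * f' x)"
  unfolding deriv_on_def
proof
  fix x assume x: "x \<in> S"
  have "(g has_real_derivative g' (f x)) (at (f x) within f ` S)"
    using assms x by (meson DERIV_subset deriv_onD image_subset_iff)
  from DERIV_image_chain[OF this deriv_onD[OF assms(2) x]]
  show "((\<lambda>x. g (f x)) has_real_derivative g' (f x) * f' x) (at x within S)"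
    by (simp add: o_def)
qed

lemma smooth_compose:
  assumes "smooth T g" "smooth S f" "f ` S \<subseteq> T"
  shows "smooth S (\<lambda>x. g (f x))"
proof (rule smooth_upto_algebra[of "\<lambda>h. \<exists>g. smooth T g \<and> h = (\<lambda>x. g (f x))" _ S])
  obtain f' where f': "deriv_on S f f'" "smooth S f'" using assms(2) by (rule smooth_deriv)
  fix h assume "\<exists>g. smooth T g \<and> h = (\<lambda>x. g (f x))"
  then obtain g g' where g: "h = (\<lambda>x. g (f x))" "deriv_on T g g'" "smooth T g'"
    by (metis smooth_deriv)
  have "algebra_over S (\<lambda>h. \<exists>g. smooth T g \<and> h = (\<lambda>x. g (f x))) (\<lambda>x. g' (f x) * f' x)"
    using f' g by (intro algebra_over.mult) (auto intro: algebra_over.generator algebra_over.smooth)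
  then show "\<exists>h'. algebra_over S (\<lambda>h. \<exists>g. smooth T g \<and> h = (\<lambda>x. g (f x))) h' \<and> deriv_on S h h'"
    using deriv_on_compose[OF g(2) f'(1) assms(3)] g(1) by blast
qed (use assms in auto)

lemma smooth_exp: "smooth S exp"
  by (rule smooth_coinduct[of "\<lambda>f. f = exp"]) (auto simp: deriv_on_def intro: DERIV_exp has_field_derivative_at_within)

lemma smooth_ln: "smooth S f \<Longrightarrow> (\<And>x. x \<in> S \<Longrightarrow> f x > 0) \<Longrightarrow> smooth S (\<lambda>x. ln (f x))"
proof -
  assume f: "smooth S f" and pos: "\<And>x. x \<in> S \<Longrightarrow> f x > 0"
  obtain f' where f': "deriv_on S f f'" "smooth S f'" using f by (rule smooth_deriv)
  have "deriv_on S (\<lambda>x. ln (f x)) (\<lambda>x. f' x / f x)"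
    using f' pos by (auto simp: deriv_on_def intro!: derivative_eq_intros)
  moreover have "smooth S (\<lambda>x. f' x / f x)"
    using f f'(2) pos by (intro smooth_divide) (auto simp: less_imp_neq[symmetric])
  ultimately show ?thesis by (rule smooth_step)
qed

lemma smooth_sin_cos: "smooth S sin" "smooth S cos"
proof -
  define P where "P f \<longleftrightarrow> f \<in> {sin, cos :: real \<Rightarrow> real, \<lambda>x. - sin x, \<lambda>x. - cos x}" for f
  have "smooth S f" if "P f" for f
  proof (rule smooth_coinduct[of P, OF that])
    fix g assume "P g"
    then consider "g = sin" | "g = cos" | "g = (\<lambda>x. - sin x)" | "g = (\<lambda>x. - cos x)"
      by (auto simp: P_def)
    then show "\<exists>f'. P f' \<and> deriv_on S g f'"
    proof cases
      case 1 then show ?thesis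
        by (intro exI[of _ cos]) (auto simp: P_def deriv_on_def intro!: derivative_eq_intros)
    next
      case 2 then show ?thesis
        by (intro exI[of _ "\<lambda>x. - sin x"]) (auto simp: P_def deriv_on_def intro!: derivative_eq_intros)
    next
      case 3 then show ?thesis
        by (intro exI[of _ "\<lambda>x. - cos x"]) (auto simp: P_def deriv_on_def intro!: derivative_eq_intros)
    next
      case 4 then show ?thesis
        by (intro exI[of _ sin]) (auto simp: P_def deriv_on_def intro!: derivative_eq_intros)
    qed
  qed
  then show "smooth S sin" "smooth S cos" by (auto simp: P_def)
qed

text \<open>Differentiation under the integral sign raises the exponent \<open>m\<close> by one and replaces \<open>f\<close> by \<open>f'\<close>;
  the weight \<open>t ^ m\<close> is there to make this class of integrals closed under derivatives.\<close>
lemma deriv_on_param_integral: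
  assumes "deriv_on S f f'" "continuous_on S f'" "convex S" "c \<in> S"
  shows "deriv_on S (\<lambda>x. integral {0..1} (\<lambda>t. t ^ m * f (c + t * (x - c))))
                    (\<lambda>x. integral {0..1} (\<lambda>t. t ^ Suc m * f' (c + t * (x - c))))"
  unfolding deriv_on_def
proof
  fix x0 assume x0: "x0 \<in> S"
  have inS: "c + t * (x - c) \<in> S" if "x \<in> S" "t \<in> {0..1}" for x t
    using convexD_alt[OF assms(3,4) that(1), of t] that by (simp add: algebra_simps)
  have "((\<lambda>x. integral (cbox 0 1) (\<lambda>t. t ^ m * f (c + t * (x - c)))) has_real_derivative
      integral (cbox 0 1) (\<lambda>t. t ^ Suc m * f' (c + t * (x0 - c)))) (at x0 within S)"
  proof (rule leibniz_rule_field_derivative[where fx = "\<lambda>x t. t ^ Suc m * f' (c + t * (x - c))"])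
    fix x t :: real assume xt: "x \<in> S" "t \<in> cbox 0 1"
    have "deriv_on S (\<lambda>x. c + t * (x - c)) (\<lambda>x. t)"
      by (auto simp: deriv_on_def intro!: derivative_eq_intros)
    moreover have "(\<lambda>x. c + t * (x - c)) ` S \<subseteq> S" using inS xt by auto
    ultimately have "((\<lambda>x. f (c + t * (x - c))) has_real_derivative f' (c + t * (x - c)) * t) (at x within S)"
      using deriv_on_compose[OF assms(1), THEN deriv_onD] xt(1) by blast
    from DERIV_cmult[OF this, of "t ^ m"]
    show "((\<lambda>x. t ^ m * f (c + t * (x - c))) has_real_derivative t ^ Suc m * f' (c + t * (x - c))) (at x within S)"
      by (simp add: ac_simps)
  next
    fix x assume x: "x \<in> S"
    show "(\<lambda>t. t ^ m * f (c + t * (x - c))) integrable_on cbox 0 1"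
      using inS x by (intro integrable_continuous continuous_intros
          continuous_on_compose2[OF deriv_on_continuous_on[OF assms(1)]]) auto
  next
    show "continuous_on (S \<times> cbox 0 1) (\<lambda>(x, t). t ^ Suc m * f' (c + t * (x - c)))"
      unfolding case_prod_beta using inS
      by (intro continuous_intros continuous_on_compose2[OF assms(2)]) auto
  qed (use x0 assms in auto)
  then show "((\<lambda>x. integral {0..1} (\<lambda>t. t ^ m * f (c + t * (x - c)))) has_real_derivative
      integral {0..1} (\<lambda>t. t ^ Suc m * f' (c + t * (x0 - c)))) (at x0 within S)"
    by simp
qed

lemma smooth_param_integral:
  assumes "smooth S f" "convex S" "c \<in> S"
  shows "smooth S (\<lambda>x. integral {0..1} (\<lambda>t. t ^ m * f (c + t * (x - c))))"
proof (rule smooth_coinduct[of "\<lambda>g. \<exists>m f. smooth S f \<and> g = (\<lambda>x. integral {0..1} (\<lambda>t. t ^ m * f (c + t * (x - c))))"])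
  fix g assume "\<exists>m f. smooth S f \<and> g = (\<lambda>x. integral {0..1} (\<lambda>t. t ^ m * f (c + t * (x - c))))"
  then obtain m f f' where g: "g = (\<lambda>x. integral {0..1} (\<lambda>t. t ^ m * f (c + t * (x - c))))"
    and "deriv_on S f f'" "smooth S f'"
    by (metis smooth_deriv)
  then show "\<exists>g'. (\<exists>m f. smooth S f \<and> g' = (\<lambda>x. integral {0..1} (\<lambda>t. t ^ m * f (c + t * (x - c))))) \<and> deriv_on S g g'"
    using deriv_on_param_integral[of S f f' c m] assms smooth_continuous_on by blast
qed (use assms in auto)

text \<open>The quotient is \<open>\<integral>\<^sub>0\<^sup>1 f' (c + t * (x - c)) dt\<close>, by the fundamental theorem of calculus along
  the segment from \<open>c\<close> to \<open>x\<close>.\<close>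
lemma hadamard_quotient:
  assumes "smooth S f" "deriv_on S f f'" "convex S" "c \<in> S" "f c = 0"
  obtains q where "smooth S q" "\<And>x. x \<in> S \<Longrightarrow> f x = (x - c) * q x" "q c = f' c"
proof -
  obtain d where d: "deriv_on S f d" "smooth S d" using assms(1) by (rule smooth_deriv)
  define q where "q x = integral {0..1} (\<lambda>t. t ^ 0 * d (c + t * (x - c)))" for x
  have q: "smooth S q"
    unfolding q_def by (rule smooth_param_integral[OF d(2) assms(3,4)])
  have feq: "f x = (x - c) * q x" if x: "x \<in> S" for x
  proof -
    have inS: "c + t * (x - c) \<in> S" if "t \<in> {0..1}" for t
      using convexD_alt[OF assms(3,4) x, of t] that by (simp add: algebra_simps)
    have "deriv_on {0..1} (\<lambda>t. c + t * (x - c)) (\<lambda>t. x - c)"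
      by (auto simp: deriv_on_def intro!: derivative_eq_intros)
    then have "deriv_on {0..1} (\<lambda>t. f (c + t * (x - c))) (\<lambda>t. d (c + t * (x - c)) * (x - c))"
      using inS by (intro deriv_on_compose[OF d(1)]) auto
    then have "((\<lambda>t. d (c + t * (x - c)) * (x - c)) has_integral f (c + 1 * (x - c)) - f (c + 0 * (x - c))) {0..1}"
      by (intro fundamental_theorem_of_calculus)
        (auto simp: deriv_on_def has_real_derivative_iff_has_vector_derivative)
    then have "((\<lambda>t. d (c + t * (x - c)) * (x - c)) has_integral f x) {0..1}"
      using assms(5) by simp
    moreover have "integral {0..1} (\<lambda>t. d (c + t * (x - c)) * (x - c)) = q x * (x - c)"
      by (simp add: q_def)
    ultimately show ?thesis by (metis integral_unique mult.commute)
  qed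
  show thesis
  proof (cases "at c within S = bot")
    case True
    have "S = {c}"
    proof -
      have False if "x \<in> S" "x \<noteq> c" for x
        using connected_imp_perfect[OF convex_connected[OF assms(3)] assms(4)] that True assms(4)
        by (auto simp: trivial_limit_within)
      then show ?thesis using assms(4) by auto
    qed
    then show thesis using assms(5) by (intro that[of "\<lambda>x. f' c"]) (auto intro: smooth_const)
  next
    case False
    obtain q' where q': "deriv_on S q q'" using q by (rule smooth_deriv)
    have "((\<lambda>x. (x - c) * q x) has_real_derivative q c) (at c within S)"
      using deriv_onD[OF q' assms(4)] by (auto intro!: derivative_eq_intros)
    then have "(f has_real_derivative q c) (at c within S)"
      using has_derivative_transform[OF assms(4), of f "\<lambda>x. (x - c) * q x"] feq
      by (simp add: has_field_derivative_def)
    then have "q c = f' c"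
      using deriv_onD[OF assms(2,4)] False
      unfolding has_field_derivative_iff by (rule tendsto_unique[rotated])
    then show thesis using that q feq by blast
  qed
qed

section \<open>Extension of smooth functions beyond the endpoints of an interval\<close>

text \<open>The remainders \<open>exp_tail n\<close> of the exponential series are the building blocks for Borel's theorem.
  The \<open>n\<close>-th one vanishes to order \<open>n\<close> at \<open>0\<close>, its derivative is the previous one, and on the negative
  axis it is bounded by a power of lower degree, so that scaling the argument by \<open>l\<close> and dividing by
  \<open>l ^ n\<close> gains a factor \<open>1 / l\<close>. Truncated subtraction in \<open>n - 1\<close>
  is intended: \<open>exp_tail 0 = exp\<close> is its own derivative.\<close>
definition exp_tail :: "nat \<Rightarrow> real \<Rightarrow> real" where
  "exp_tail n x = exp x - (\<Sum>i<n. x ^ i / fact i)"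

lemma exp_tail_deriv: "(exp_tail n has_real_derivative exp_tail (n - 1) x) (at x within S)"
proof -
  have "((\<lambda>x. x ^ Suc i / fact (Suc i)) has_real_derivative x ^ i / fact i) (at x within S)" for i
  proof -
    have "((\<lambda>x. x ^ Suc i / fact (Suc i)) has_real_derivative real (Suc i) * x ^ i / fact (Suc i)) (at x within S)"
      by (rule DERIV_cdivide) (auto intro!: derivative_eq_intros simp del: power_Suc)
    also have "real (Suc i) * x ^ i / fact (Suc i) = x ^ i / fact i"
      by (simp del: of_nat_Suc)
    finally show ?thesis .
  qed
  then have *: "((\<lambda>x. \<Sum>i<m. x ^ Suc i / fact (Suc i)) has_real_derivative (\<Sum>i<m. x ^ i / fact i)) (at x within S)" for m
    by (intro DERIV_sum) auto
  show ?thesis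
  proof (cases n)
    case 0 then show ?thesis by (simp add: exp_tail_def[abs_def] has_field_derivative_at_within)
  next
    case (Suc m)
    have "((\<lambda>x. exp x - (1 + (\<Sum>i<m. x ^ Suc i / fact (Suc i)))) has_real_derivative exp x - (0 + (\<Sum>i<m. x ^ i / fact i))) (at x within S)"
      by (intro DERIV_diff DERIV_add *) (auto intro: has_field_derivative_at_within)
    then show ?thesis
      unfolding Suc exp_tail_def[abs_def] sum.lessThan_Suc_shift by simp
  qed
qed

lemma exp_tail_0: "exp_tail n 0 = (if n = 0 then 1 else 0)"
  by (cases n) (auto simp: exp_tail_def sum.lessThan_Suc_shift simp del: sum.lessThan_Suc)

text \<open>Lagrange's remainder gives \<open>exp_tail (Suc n) x = (exp t - 1) * x ^ n / n!\<close> for some \<open>t \<le> 0\<close>, and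
  \<open>exp t\<close> lies between \<open>0\<close> and \<open>1\<close>.\<close>
lemma exp_tail_bound:
  assumes "x \<le> 0"
  shows "\<bar>exp_tail (Suc n) x\<bar> \<le> \<bar>x\<bar> ^ n / fact n"
proof -
  have "\<exists>t\<le>0. exp x = (\<Sum>i<n. x ^ i / fact i) + exp t / fact n * x ^ n"
  proof (cases "x = 0 \<or> n = 0")
    case True
    then show ?thesis using assms
      by (cases n) (auto simp: sum.lessThan_Suc_shift simp del: sum.lessThan_Suc)
  next
    case False
    with Maclaurin_minus[of x n "\<lambda>_. exp" exp] assms
    have "\<exists>t. x < t \<and> t < 0 \<and> exp x = (\<Sum>m<n. exp 0 / fact m * x ^ m) + exp t / fact n * x ^ n"
      by auto
    then show ?thesis by (auto intro: less_imp_le)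
  qed
  then obtain t where t: "t \<le> 0" "exp x = (\<Sum>i<n. x ^ i / fact i) + exp t / fact n * x ^ n" by auto
  have "exp_tail (Suc n) x = (exp t - 1) * (x ^ n / fact n)"
    using t(2) by (simp add: exp_tail_def left_diff_distrib diff_divide_distrib)
  then have "\<bar>exp_tail (Suc n) x\<bar> = \<bar>exp t - 1\<bar> * (\<bar>x\<bar> ^ n / fact n)"
    by (simp add: abs_mult power_abs)
  also have "\<dots> \<le> 1 * (\<bar>x\<bar> ^ n / fact n)"
    using t(1) exp_gt_zero[of t] by (intro mult_right_mono) (auto simp: abs_if)
  finally show ?thesis by simp
qed

text \<open>Borel's theorem on one side of \<open>0\<close>. The function is \<open>\<Sum>n. c n / l n ^ n * exp_tail n (l n * x)\<close> with
  \<open>l n = 1 + \<bar>c n\<bar>\<close>. For \<open>n > j\<close> the \<open>j\<close>-th derivative of the \<open>n\<close>-th term is at most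
  \<open>\<bar>x\<bar> ^ (n - j - 1) / (n - j - 1)!\<close>, whatever the coefficients, and at \<open>0\<close> it vanishes. So the series
  may be differentiated termwise and its \<open>j\<close>-th derivative at \<open>0\<close> is \<open>c j\<close> plus an expression in the
  earlier coefficients, which determines \<open>c\<close> recursively.\<close>
lemma borel_one_sided:
  fixes a :: "nat \<Rightarrow> real"
  assumes "R \<ge> 0"
  obtains D where "tower_on {-R..0} D" "\<And>k. D k 0 = a k"
proof -
  have "\<exists>c. \<forall>j. c j = a j - (\<Sum>n<j. c n * (1 + \<bar>c n\<bar>) ^ (j - n))"
  proof -
    define c where "c = wfrec {(m, n). m < n} (\<lambda>c j. a j - (\<Sum>n<j. c n * (1 + \<bar>c n :: real\<bar>) ^ (j - n)))"
    have "c j = a j - (\<Sum>n<j. c n * (1 + \<bar>c n\<bar>) ^ (j - n))" for j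
      unfolding c_def by (subst wfrec[OF wf_less]) (auto simp: cut_apply intro!: sum.cong)
    then show ?thesis by blast
  qed
  then obtain c where c: "\<And>j. c j = a j - (\<Sum>n<j. c n * (1 + \<bar>c n\<bar>) ^ (j - n))" by blast
  define l where "l n = 1 + \<bar>c n\<bar>" for n
  have l: "l n \<ge> 1" "l n > 0" "l n \<noteq> 0" "\<bar>c n\<bar> \<le> l n" for n by (auto simp: l_def)
  \<comment> \<open>the \<open>j\<close>-th derivative of the \<open>n\<close>-th term; for \<open>n < j\<close> truncated subtraction yields \<open>exp\<close>\<close>
  define u where "u j n x = c n * l n ^ j / l n ^ n * exp_tail (n - j) (l n * x)" for j n x
  define D where "D j x = (\<Sum>n. u j n x)" for j x
  have du: "(u j n has_real_derivative u (Suc j) n x) (at x within S)" for j n x S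
  proof -
    have "((\<lambda>x. exp_tail (n - j) (l n * x)) has_real_derivative exp_tail (n - j - 1) (l n * x) * l n) (at x within S)"
      by (rule DERIV_chain'[where g = "exp_tail (n - j)", OF _ exp_tail_deriv])
        (auto intro!: derivative_eq_intros)
    from DERIV_cmult[OF this, of "c n * l n ^ j / l n ^ n"] show ?thesis
      by (simp add: u_def[abs_def] ac_simps)
  qed
  have bound: "\<bar>u j n x\<bar> \<le> R ^ (n - Suc j) / fact (n - Suc j)" if "n \<ge> Suc j" "x \<in> {-R..0}" for j n x
  proof -
    define m where "m = n - Suc j"
    have n: "n = Suc (m + j)" using that by (simp add: m_def)
    have "\<bar>u j n x\<bar> = \<bar>c n\<bar> / l n ^ Suc m * \<bar>exp_tail (Suc m) (l n * x)\<bar>"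
      using l[of n] by (simp add: u_def n power_add abs_mult)
    also have "\<dots> \<le> \<bar>c n\<bar> / l n ^ Suc m * (\<bar>l n * x\<bar> ^ m / fact m)"
      using l[of n] that by (intro mult_left_mono exp_tail_bound) (auto simp: mult_nonneg_nonpos)
    also have "\<dots> = \<bar>c n\<bar> / l n * (\<bar>x\<bar> ^ m / fact m)"
      using l[of n] by (simp add: abs_mult power_mult_distrib)
    also have "\<dots> \<le> 1 * (\<bar>x\<bar> ^ m / fact m)"
      using l[of n] by (intro mult_right_mono) auto
    also have "\<dots> \<le> R ^ m / fact m"
      using that by (auto intro!: divide_right_mono power_mono)
    finally show ?thesis by (simp add: m_def)
  qed
  have summ: "summable (\<lambda>n. R ^ (n - Suc j) / fact (n - Suc j))" for j
  proof -
    have "summable (\<lambda>n. R ^ (n + Suc j - Suc j) / fact (n + Suc j - Suc j))"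
      using summable_exp[of R] by (simp add: divide_inverse mult.commute)
    then show ?thesis
      by (rule summable_iff_shift[of "\<lambda>n. R ^ (n - Suc j) / fact (n - Suc j)" "Suc j", THEN iffD1])
  qed
  have unif: "uniform_limit {-R..0} (\<lambda>N x. \<Sum>n<N. u j n x) (D j) sequentially" for j
    unfolding D_def
    by (rule Weierstrass_m_test_ev[OF _ summ[of j]])
      (auto intro!: eventually_sequentiallyI[of "Suc j"] bound)
  have summ0: "summable (\<lambda>n. u j n x)" if "x \<in> {-R..0}" for j x
    using tendsto_uniform_limitI[OF unif that] unfolding summable_def sums_def by blast
  have "deriv_on {-R..0} (D j) (D (Suc j))" for j
  proof -
    have "\<exists>g. \<forall>x\<in>{-R..0}. (\<lambda>n. u j n x) sums g x \<and> (g has_real_derivative D (Suc j) x) (at x within {-R..0})"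
    proof (rule has_field_derivative_series)
      show "uniform_limit {-R..0} (\<lambda>N x. \<Sum>n<N. u (Suc j) n x) (D (Suc j)) sequentially" by (rule unif)
      show "summable (\<lambda>n. u j n 0)" using assms by (intro summ0) auto
    qed (use assms du in auto)
    then obtain g where g: "\<And>x. x \<in> {-R..0} \<Longrightarrow> (\<lambda>n. u j n x) sums g x"
      "deriv_on {-R..0} g (D (Suc j))" unfolding deriv_on_def by blast
    then show ?thesis
      using deriv_on_cong[of "{-R..0}" g "D j" "D (Suc j)" "D (Suc j)"] by (simp add: D_def sums_iff)
  qed
  then have "tower_on {-R..0} D" by (simp add: tower_on_def)
  moreover have "D j 0 = a j" for j
  proof -
    have "D j 0 = (\<Sum>n\<in>{..j}. u j n 0)"
      unfolding D_def by (rule suminf_finite) (auto simp: u_def exp_tail_0)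
    also have "\<dots> = (\<Sum>n<j. u j n 0) + u j j 0" by (simp add: lessThan_Suc_atMost[symmetric])
    also have "(\<Sum>n<j. u j n 0) = (\<Sum>n<j. c n * (1 + \<bar>c n\<bar>) ^ (j - n))"
      using l by (intro sum.cong) (auto simp: u_def exp_tail_0 l_def[symmetric] power_diff)
    also have "u j j 0 = c j" using l[of j] by (simp add: u_def exp_tail_0)
    finally show ?thesis using c[of j] by simp
  qed
  ultimately show thesis by (rule that)
qed

text \<open>At a common point of the two closed sets the derivatives within both sets exist and agree; at any
  other point only one of the sets contributes to the limit.\<close>
lemma tower_on_glue:
  assumes S: "tower_on S D" "closed S" and T: "tower_on T E" "closed T"
    and eq: "\<And>k x. x \<in> S \<inter> T \<Longrightarrow> D k x = E k x"
  shows "tower_on (S \<union> T) (\<lambda>k x. if x \<in> S then D k x else E k x)"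
  unfolding tower_on_def
proof
  fix k
  define G where "G k x = (if x \<in> S then D k x else E k x)" for k x
  have GS: "deriv_on S (G k) (G (Suc k))"
    using S(1) deriv_on_cong[of S "G k" "D k" "G (Suc k)" "D (Suc k)"] by (simp add: G_def tower_on_def)
  have GE: "G k x = E k x" if "x \<in> T" for k x using eq that by (auto simp: G_def)
  have GT: "deriv_on T (G k) (G (Suc k))"
    using T(1) GE deriv_on_cong[of T "G k" "E k" "G (Suc k)" "E (Suc k)"] by (simp add: tower_on_def)
  show "deriv_on (S \<union> T) (\<lambda>x. if x \<in> S then D k x else E k x) (\<lambda>x. if x \<in> S then D (Suc k) x else E (Suc k) x)"
    unfolding G_def[symmetric] deriv_on_def
  proof
    fix x assume x: "x \<in> S \<union> T"
    have *: "(f has_real_derivative d) (at x within A)" if "x \<notin> A" "closed A" for f d A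
      using that not_in_closure_trivial_limitI[of x A] by (simp add: has_field_derivative_iff)
    have "(G k has_real_derivative G (Suc k) x) (at x within S)"
         "(G k has_real_derivative G (Suc k) x) (at x within T)"
      using * S(2) T(2) GS GT by (metis deriv_onD)+
    then show "(G k has_real_derivative G (Suc k) x) (at x within S \<union> T)"
      unfolding has_field_derivative_iff by (rule Lim_Un)
  qed
qed

lemma tower_on_reflect:
  assumes "tower_on S D"
  shows "tower_on ((\<lambda>x. c - x) ` S) (\<lambda>k x. (-1) ^ k * D k (c - x))"
  unfolding tower_on_def
proof
  fix k
  let ?T = "(\<lambda>x. c - x) ` S"
  have "deriv_on ?T (\<lambda>x. c - x) (\<lambda>x. -1)"
    by (auto simp: deriv_on_def intro!: derivative_eq_intros)
  then have "deriv_on ?T (\<lambda>x. D k (c - x)) (\<lambda>x. D (Suc k) (c - x) * -1)"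
    using assms by (intro deriv_on_compose[where T = S]) (auto simp: tower_on_def)
  then show "deriv_on ?T (\<lambda>x. (-1) ^ k * D k (c - x)) (\<lambda>x. (-1) ^ Suc k * D (Suc k) (c - x))"
    using DERIV_cmult[where c = "(-1) ^ k"] unfolding deriv_on_def by fastforce
qed

lemma tower_extend_left:
  assumes "tower_on {a..b} D" "a \<le> b" "R \<ge> 0"
  obtains E where "tower_on {a - R..b} E" "\<And>k x. x \<in> {a..b} \<Longrightarrow> E k x = D k x"
proof -
  \<comment> \<open>the signs anticipate those produced by reflecting twice\<close>
  obtain B where B: "tower_on {-R..0} B" "\<And>k. B k 0 = (-1) ^ k * ((-1) ^ k * D k a)"
    using borel_one_sided[OF assms(3), of "\<lambda>k. (-1) ^ k * ((-1) ^ k * D k a)"] by blast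
  \<comment> \<open>translation by \<open>a\<close> is the composition of the reflections about \<open>0\<close> and \<open>a / 2\<close>\<close>
  have "tower_on {a - R..a} (\<lambda>k x. B k (x - a))"
  proof -
    have "(\<lambda>x. a - x) ` (\<lambda>x. 0 - x) ` {-R..0} = {a - R..a}"
      by (simp add: image_diff_atLeastAtMost)
    moreover note tower_on_reflect[OF tower_on_reflect[OF B(1), of 0], of a]
    ultimately show ?thesis by (simp add: mult.assoc[symmetric] power_mult_distrib[symmetric])
  qed
  from tower_on_glue[OF assms(1) _ this]
  have "tower_on ({a..b} \<union> {a - R..a}) (\<lambda>k x. if x \<in> {a..b} then D k x else B k (x - a))"
    using B(2) assms by (auto simp: power_mult_distrib[symmetric] mult.assoc[symmetric])
  moreover have "{a..b} \<union> {a - R..a} = {a - R..b}" using assms by auto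
  ultimately have "tower_on {a - R..b} (\<lambda>k x. if x \<in> {a..b} then D k x else B k (x - a))" by simp
  then show thesis by (rule that) simp
qed

lemma smooth_extend:
  assumes "smooth {a..b} f" "a \<le> b" "R \<ge> 0"
  obtains g where "smooth {a - R..b + R} g" "\<And>x. x \<in> {a..b} \<Longrightarrow> g x = f x"
proof -
  obtain D where D: "tower_on {a..b} D" "D 0 = f" using assms(1) by (auto simp: smooth_def)
  obtain E where E: "tower_on {a - R..b} E" "\<And>k x. x \<in> {a..b} \<Longrightarrow> E k x = D k x"
    using tower_extend_left[OF D(1) assms(2,3)] by blast
  have "tower_on {-b..-(a-R)} (\<lambda>k x. (-1) ^ k * E k (0 - x))"
    using tower_on_reflect[OF E(1), of 0] by (simp add: image_diff_atLeastAtMost)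
  then obtain G where G: "tower_on {-b-R..-(a-R)} G"
      "\<And>k x. x \<in> {-b..-(a-R)} \<Longrightarrow> G k x = (-1) ^ k * E k (0 - x)"
    by (rule tower_extend_left) (use assms in auto)
  have "tower_on {a - R..b + R} (\<lambda>k x. (-1) ^ k * G k (0 - x))"
    using tower_on_reflect[OF G(1), of 0] by (simp add: image_diff_atLeastAtMost add.commute)
  then have "smooth {a - R..b + R} (\<lambda>x. G 0 (- x))" by (auto simp: smooth_def intro!: exI)
  then show thesis by (rule that) (use G(2) E(2) D(2) assms in auto)
qed

section \<open>Antiderivatives, inverse functions and even functions of an angle\<close>

text \<open>On a nondegenerate closed interval the derivative within the interval is unique, so the iterated
  Frechet derivatives agree with those of the tower up to constant factors.\<close>
lemma smooth_imp_smooth_on: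
  assumes "a < b" "smooth {a..b} f"
  shows "smooth_on {a..b} f"
proof -
  have "k_smooth_on k {a..b} f" for k
    using assms(2)
  proof (induction k arbitrary: f)
    case 0 then show ?case by (simp add: smooth_continuous_on)
  next
    case (Suc k)
    obtain f' where f': "deriv_on {a..b} f f'" "smooth {a..b} f'" using Suc.prems by (rule smooth_deriv)
    have der: "(f has_derivative (*) (f' x)) (at x within {a..b})" if "x \<in> {a..b}" for x
      using deriv_onD[OF f'(1) that] by (simp add: has_field_derivative_def)
    have fd: "frechet_derivative f (at x within {a..b}) = (*) (f' x)" if "x \<in> {a..b}" for x
      using frechet_derivative_within_cbox[of a b x f "(*) (f' x)"] der[OF that] that assms(1) by simp
    have "smooth {a..b} (\<lambda>x. frechet_derivative f (at x within {a..b}) v)" for v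
      by (rule smooth_cong[OF smooth_mult[OF f'(2) smooth_const[of _ v]]]) (simp add: fd)
    moreover have "f differentiable_on {a..b}"
      unfolding differentiable_on_def using differentiableI[OF der] by blast
    ultimately show ?case using Suc.IH by simp
  qed
  then show ?thesis by (simp add: smooth_on_def)
qed

text \<open>If the derivative in the interior extends continuously to the endpoints, then it is the one-sided
  derivative there, since \<open>f\<close> is an integral of it.\<close>
lemma deriv_on_closed_interval:
  assumes "a \<le> b" "continuous_on {a..b} f" "continuous_on {a..b} f'"
    and "\<And>x. a < x \<Longrightarrow> x < b \<Longrightarrow> (f has_real_derivative f' x) (at x)"
  shows "deriv_on {a..b} f f'"
proof -
  have "f x = f a + integral {a..x} f'" if "x \<in> {a..b}" for x
  proof -
    have "(f' has_integral f x - f a) {a..x}"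
    proof (rule fundamental_theorem_of_calculus_interior)
      show "continuous_on {a..x} f" by (rule continuous_on_subset[OF assms(2)]) (use that in auto)
      show "(f has_vector_derivative f' y) (at y)" if "y \<in> {a<..<x}" for y
        using assms(4)[of y] that \<open>x \<in> {a..b}\<close>
        by (simp add: has_real_derivative_iff_has_vector_derivative)
    qed (use that in auto)
    then show ?thesis by (simp add: integral_unique)
  qed
  moreover have "deriv_on {a..b} (\<lambda>x. f a + integral {a..x} f') f'"
    unfolding deriv_on_def
    using DERIV_add[OF DERIV_const integral_has_real_derivative[OF assms(3)]] by simp
  ultimately show ?thesis
    using deriv_on_cong[of "{a..b}" f "\<lambda>x. f a + integral {a..x} f'" f' f'] by blast
qed

lemma smooth_antiderivative:
  assumes "smooth {a..b} v" "c \<in> {a..b}"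
  obtains Y where "deriv_on {a..b} Y v" "smooth {a..b} Y" "Y c = 0"
proof -
  define Y where "Y x = integral {a..x} v - integral {a..c} v" for x
  have "deriv_on {a..b} Y v"
    unfolding deriv_on_def Y_def
    using DERIV_diff[OF integral_has_real_derivative[OF smooth_continuous_on[OF assms(1)]] DERIV_const]
    by simp
  then show thesis using that smooth_step assms by (simp add: Y_def)
qed

text \<open>An open interval that contains \<open>[0, \<pi>]\<close> and on which the sine vanishes only at \<open>0\<close> and \<open>\<pi>\<close>, where it
  has simple zeros.\<close>
definition strip :: "real set" where "strip = {-pi<..<2 * pi}"

text \<open>These are the symmetries that an axisymmetric norm has as a function of the angle from the axis. The
  two ranges are the largest ones on which the respective reflection stays inside the strip.\<close>
definition doubly_even :: "(real \<Rightarrow> real) \<Rightarrow> bool" where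
  "doubly_even f \<longleftrightarrow> (\<forall>x\<in>{-pi<..<pi}. f (- x) = f x) \<and> (\<forall>x\<in>{0<..<2 * pi}. f (2 * pi - x) = f x)"

lemma sin_strip_nonzero:
  assumes "x \<in> strip" "x \<noteq> 0" "x \<noteq> pi" shows "sin x \<noteq> 0"
proof
  assume "sin x = 0"
  then obtain i :: int where i: "x = of_int i * pi" by (auto simp: sin_zero_iff_int2)
  with assms have "-1 * pi < of_int i * pi" "of_int i * pi < 2 * pi" by (auto simp: strip_def)
  then have "real_of_int (-1) < of_int i" "of_int i < real_of_int 2"
    using pi_gt_zero by (simp_all only: mult_less_cancel_right_pos of_int_minus of_int_1 of_int_numeral)
  then have "-1 < i" "i < 2" by (simp_all only: of_int_less_iff)
  then have "i = 0 \<or> i = 1" by auto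
  with i assms show False by auto
qed

text \<open>Two Hadamard quotients show that \<open>f\<close> and \<open>sin\<close> both have the form \<open>x * (x - \<pi>)\<close> times a smooth
  function, and the factor belonging to the sine has no zeros in the strip.\<close>
lemma smooth_divide_sin:
  assumes "smooth strip f" "f 0 = 0" "f pi = 0"
  obtains n where "smooth strip n" "\<And>x. x \<in> strip \<Longrightarrow> f x = sin x * n x"
proof -
  have S: "convex strip" "0 \<in> strip" "pi \<in> strip" by (auto simp: strip_def)
  have div2: "\<exists>q. smooth strip q \<and> (\<forall>x\<in>strip. u x = x * (x - pi) * q x)"
    if u: "smooth strip u" "u 0 = 0" "u pi = 0" for u
  proof -
    obtain q1 where q1: "smooth strip q1" "\<And>x. x \<in> strip \<Longrightarrow> u x = (x - 0) * q1 x"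
      using hadamard_quotient[OF u(1) _ S(1,2) u(2)] smooth_deriv[OF u(1)] by metis
    then have "q1 pi = 0" using u(3) S(3) by fastforce
    then obtain q2 where "smooth strip q2" "\<And>x. x \<in> strip \<Longrightarrow> q1 x = (x - pi) * q2 x"
      using hadamard_quotient[OF q1(1) _ S(1,3)] smooth_deriv[OF q1(1)] by metis
    with q1(2) show ?thesis by (auto intro!: exI[of _ q2])
  qed
  obtain p where p: "smooth strip p" "\<And>x. x \<in> strip \<Longrightarrow> f x = x * (x - pi) * p x"
    using div2[OF assms] by blast
  obtain s where s: "smooth strip s" "\<And>x. x \<in> strip \<Longrightarrow> sin x = x * (x - pi) * s x"
    using div2[of sin] smooth_sin_cos by auto
  have "s x \<noteq> 0" if x: "x \<in> strip" for x
  proof (cases "x = 0 \<or> x = pi")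
    case False then show ?thesis using sin_strip_nonzero[OF x] s(2)[OF x] by auto
  next
    case True
    obtain s' where s': "deriv_on strip s s'" using smooth_deriv[OF s(1)] by metis
    have "open strip" by (simp add: strip_def)
    then have "(s has_real_derivative s' x) (at x)"
      using deriv_on_openD[OF s'] x by blast
    then have "((\<lambda>x. x * (x - pi) * s x) has_real_derivative (2 * x - pi) * s x) (at x)"
      using True by (auto intro!: derivative_eq_intros simp: algebra_simps)
    then have "(sin has_real_derivative (2 * x - pi) * s x) (at x)"
      by (rule has_field_derivative_transform_within_open[OF _ \<open>open strip\<close> x]) (simp add: s(2))
    from DERIV_unique[OF this DERIV_sin] have "(2 * x - pi) * s x = cos x" .
    moreover have "cos x \<noteq> 0" using True by auto
    ultimately show ?thesis by auto
  qed
  then have "smooth strip (\<lambda>x. p x / s x)" using p s by (intro smooth_divide) auto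
  moreover have "f x = sin x * (p x / s x)" if "x \<in> strip" for x
    using p(2) s(2) that \<open>\<And>x. x \<in> strip \<Longrightarrow> s x \<noteq> 0\<close> by simp
  ultimately show thesis by (rule that)
qed

text \<open>The derivative of a doubly even function is odd about \<open>0\<close> and \<open>\<pi>\<close>, hence divisible by the sine, with a
  quotient that is doubly even again. Because \<open>arccos\<close> has derivative \<open>-1 / sin arccos\<close>, the singular
  factors cancel in the derivative of \<open>f \<circ> arccos\<close>.\<close>
lemma doubly_even_deriv:
  assumes "smooth strip f" "doubly_even f"
  obtains n where "smooth strip n" "doubly_even n" "deriv_on strip f (\<lambda>x. - sin x * n x)"
    "deriv_on {-1..1} (\<lambda>x. f (arccos x)) (\<lambda>x. n (arccos x))"
proof -
  have op: "open strip" by (simp add: strip_def)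
  obtain f' where f': "deriv_on strip f f'" "smooth strip f'" using assms(1) by (rule smooth_deriv)
  have der: "(f has_real_derivative f' x) (at x)" if "x \<in> strip" for x
    using deriv_on_openD[OF f'(1) op that] .
  have odd: "f' (c - x) = - f' x"
    if "x \<in> A" "open A" "A \<subseteq> strip" "c - x \<in> strip" "\<And>x. x \<in> A \<Longrightarrow> f (c - x) = f x" for A c x
  proof -
    have "((\<lambda>x. f (c - x)) has_real_derivative f' (c - x) * (0 - 1)) (at x)"
      by (rule DERIV_chain2[of f]) (use der[OF that(4)] in \<open>auto intro!: derivative_eq_intros\<close>)
    then have "(f has_real_derivative f' (c - x) * (0 - 1)) (at x)"
      by (rule has_field_derivative_transform_within_open[OF _ that(2,1)]) (use that in auto)
    from DERIV_unique[OF this der] that show ?thesis by auto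
  qed
  have sub: "{-pi<..<pi} \<subseteq> strip" "{0<..<2 * pi} \<subseteq> strip"
    unfolding strip_def greaterThanLessThan_subseteq_greaterThanLessThan using pi_gt_zero by simp_all
  have odd0: "f' (- x) = - f' x" if "x \<in> {-pi<..<pi}" for x
    using odd[OF that _ sub(1), of 0] that assms(2) by (auto simp: strip_def doubly_even_def)
  have oddpi: "f' (2 * pi - x) = - f' x" if "x \<in> {0<..<2 * pi}" for x
    using odd[OF that _ sub(2), of "2 * pi"] that assms(2) by (auto simp: strip_def doubly_even_def)
  have "f' 0 = 0" "f' pi = 0" using odd0[of 0] oddpi[of pi] by auto
  then obtain n where n: "smooth strip n" "\<And>x. x \<in> strip \<Longrightarrow> - f' x = sin x * n x"
    using smooth_divide_sin[OF smooth_minus[OF f'(2)]] by auto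
  have d: "deriv_on strip f (\<lambda>x. - sin x * n x)"
    using f'(1) n(2) deriv_on_cong[of strip f f f' "\<lambda>x. - sin x * n x"] by simp (metis minus_minus)
  have "doubly_even n"
    unfolding doubly_even_def
  proof (intro conjI ballI)
    fix x assume x: "x \<in> {-pi<..<pi}"
    then have "x \<in> strip" "- x \<in> strip" by (auto simp: strip_def)
    then have "sin x * n (- x) = sin x * n x"
      using n(2)[of x] n(2)[of "- x"] odd0[OF x] by (metis minus_mult_left minus_minus sin_minus)
    then have "sin x = 0 \<or> n (- x) = n x" by (metis mult_cancel_left)
    then show "n (- x) = n x" using sin_strip_nonzero[of x] x \<open>x \<in> strip\<close> by (cases "x = 0") auto
  next
    fix x assume x: "x \<in> {0<..<2 * pi}"
    then have "x \<in> strip" "2 * pi - x \<in> strip" by (auto simp: strip_def)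
    then have "sin x * n (2 * pi - x) = sin x * n x"
      using n(2)[of x] n(2)[of "2 * pi - x"] oddpi[OF x] sin_2pi_minus[of x]
      by (metis minus_mult_left minus_minus)
    then have "sin x = 0 \<or> n (2 * pi - x) = n x" by (metis mult_cancel_left)
    then show "n (2 * pi - x) = n x" using sin_strip_nonzero[of x] x \<open>x \<in> strip\<close> by (cases "x = pi") auto
  qed
  moreover have "deriv_on {-1..1} (\<lambda>x. f (arccos x)) (\<lambda>x. n (arccos x))"
  proof (rule deriv_on_closed_interval)
    have "arccos x \<in> strip" if "x \<in> {-1..1}" for x
      using arccos_lbound[of x] arccos_ubound[of x] pi_gt_zero that
      unfolding strip_def atLeastAtMost_iff greaterThanLessThan_iff by linarith
    then have sub: "arccos ` {-1..1} \<subseteq> strip" by blast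
    show "continuous_on {-1..1} (\<lambda>x. f (arccos x))" "continuous_on {-1..1} (\<lambda>x. n (arccos x))"
      by (rule continuous_on_compose2[OF _ continuous_on_arccos' sub],
          rule smooth_continuous_on, rule assms n)+
    fix x :: real assume x: "-1 < x" "x < 1"
    define t where "t = arccos x"
    have t: "t \<in> strip" "sin t > 0" "sin t = sqrt (1 - x\<^sup>2)"
      using x \<open>\<And>x. x \<in> {-1..1} \<Longrightarrow> arccos x \<in> strip\<close>[of x] arccos_lt_bounded[of x]
        sin_gt_zero[of "arccos x"] sin_arccos[of x]
      by (simp_all add: t_def)
    have "((\<lambda>x. f (arccos x)) has_real_derivative (- sin t * n t) * inverse (- sqrt (1 - x\<^sup>2))) (at x)"
      using DERIV_chain2[OF deriv_on_openD[OF d op t(1), unfolded t_def] DERIV_arccos[OF x]]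
      unfolding t_def by simp
    moreover have "(- sin t * n t) * inverse (- sqrt (1 - x\<^sup>2)) = n t"
      unfolding t(3)[symmetric] using t(2) by simp
    ultimately show "((\<lambda>x. f (arccos x)) has_real_derivative n (arccos x)) (at x)"
      by (simp only: t_def)
  qed simp
  ultimately show thesis by (rule that[OF n(1) _ d])
qed

text \<open>Whitney's theorem on even functions, in trigonometric form: the compositions of doubly even smooth
  functions with \<open>arccos\<close> form a class that is closed under derivatives.\<close>
lemma smooth_doubly_even_arccos:
  assumes "smooth strip f" "doubly_even f"
  shows "smooth {-1..1} (\<lambda>x. f (arccos x))"
proof (rule smooth_coinduct[of "\<lambda>g. \<exists>f. smooth strip f \<and> doubly_even f \<and> g = (\<lambda>x. f (arccos x))"])
  fix g assume "\<exists>f. smooth strip f \<and> doubly_even f \<and> g = (\<lambda>x. f (arccos x))"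
  then obtain f where f: "smooth strip f" "doubly_even f" "g = (\<lambda>x. f (arccos x))" by blast
  obtain n where "smooth strip n" "doubly_even n" "deriv_on strip f (\<lambda>x. - sin x * n x)"
      "deriv_on {-1..1} (\<lambda>x. f (arccos x)) (\<lambda>x. n (arccos x))"
    by (rule doubly_even_deriv[OF f(1,2)])
  then show "\<exists>g'. (\<exists>f. smooth strip f \<and> doubly_even f \<and> g' = (\<lambda>x. f (arccos x))) \<and> deriv_on {-1..1} g g'"
    using f(3) by blast
qed (use assms in blast)

lemma deriv_on_pos_imp_strict_mono:
  assumes "deriv_on {a..b} f f'" "\<And>x. x \<in> {a..b} \<Longrightarrow> f' x > 0" "x \<in> {a..b}" "y \<in> {a..b}" "x < y"
  shows "f x < f y"
proof (rule DERIV_pos_imp_increasing_open[OF assms(5)])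
  fix z assume "x < z" "z < y"
  then show "\<exists>d. (f has_real_derivative d) (at z) \<and> 0 < d"
    using assms deriv_onD[OF assms(1), of z] at_within_Icc_at[of a z b] by auto
next
  show "continuous_on {x..y} f"
    using assms by (intro continuous_on_subset[OF deriv_on_continuous_on[OF assms(1)]]) auto
qed

text \<open>The functions \<open>k \<circ> X\<close> with \<open>k\<close> smooth form a class closed under derivatives, since
  \<open>(k \<circ> X)' = (k' / h') \<circ> X\<close>.\<close>
lemma smooth_inverse_function:
  assumes "a < b" "smooth {a..b} h" "deriv_on {a..b} h h'" "smooth {a..b} h'"
    and pos: "\<And>x. x \<in> {a..b} \<Longrightarrow> h' x > 0"
  obtains X v where "deriv_on {h a..h b} X v" "smooth {h a..h b} v"
    "\<And>x. x \<in> {a..b} \<Longrightarrow> X (h x) = x" "\<And>x. x \<in> {a..b} \<Longrightarrow> v (h x) = inverse (h' x)"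
    "\<And>s. s \<in> {h a..h b} \<Longrightarrow> v s > 0" "\<And>x. x \<in> {a..b} \<Longrightarrow> h x \<in> {h a..h b}"
proof -
  note mono = deriv_on_pos_imp_strict_mono[OF assms(3) pos]
  have inj: "inj_on h {a..b}"
    by (rule linorder_inj_onI) (use mono in fastforce)+
  have range: "h x \<in> {h a..h b}" if "x \<in> {a..b}" for x
    using mono[of a x] mono[of x b] that by (cases "x = a"; cases "x = b") auto
  have cont: "continuous_on {a..b} h" using assms(2) by (rule smooth_continuous_on)
  have img: "h ` {a..b} = {h a..h b}"
  proof
    show "{h a..h b} \<subseteq> h ` {a..b}"
      using IVT'[of h a _ b] cont assms(1) by (force simp: image_iff)
  qed (use range in auto)
  define X where "X = inv_into {a..b} h"
  have X: "X (h x) = x" if "x \<in> {a..b}" for x using inj that by (simp add: X_def)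
  have XS: "X ` {h a..h b} \<subseteq> {a..b}" using X unfolding img[symmetric] by auto
  have contX: "continuous_on {h a..h b} X"
    using continuous_on_inv[OF cont compact_Icc] X img by auto
  define v where "v s = inverse (h' (X s))" for s
  have dX: "deriv_on {h a..h b} X v"
    unfolding deriv_on_def img[symmetric]
  proof safe
    fix x assume x: "x \<in> {a..b}"
    have "(X has_derivative (*) (inverse (h' x))) (at (h x) within h ` {a..b})"
    proof (rule has_derivative_inverse_within)
      show "(h has_derivative (*) (h' x)) (at x within {a..b})"
        using deriv_onD[OF assms(3) x] by (simp add: has_field_derivative_def)
      show "continuous (at (h x) within h ` {a..b}) X"
        using contX x unfolding img[symmetric] continuous_on_eq_continuous_within by blast
      show "(*) (inverse (h' x)) \<circ> (*) (h' x) = id" using pos[OF x] by (auto simp: fun_eq_iff)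
    qed (use x X in \<open>auto intro!: bounded_linear.linear bounded_linear_mult_right\<close>)
    then show "(X has_real_derivative v (h x)) (at (h x) within h ` {a..b})"
      using x by (simp add: has_field_derivative_def v_def X)
  qed
  have sv: "smooth {h a..h b} (\<lambda>s. k (X s))" if "smooth {a..b} k" for k
  proof (rule smooth_coinduct[of "\<lambda>f. \<exists>k. smooth {a..b} k \<and> f = (\<lambda>s. k (X s))"])
    fix f assume "\<exists>k. smooth {a..b} k \<and> f = (\<lambda>s. k (X s))"
    then obtain k k' where k: "f = (\<lambda>s. k (X s))" "deriv_on {a..b} k k'" "smooth {a..b} k'"
      by (metis smooth_deriv)
    have "smooth {a..b} (\<lambda>x. k' x * inverse (h' x))"
      using pos by (intro smooth_mult k smooth_inverse assms) (auto simp: less_imp_neq[symmetric])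
    moreover have "deriv_on {h a..h b} f (\<lambda>s. k' (X s) * inverse (h' (X s)))"
      using deriv_on_compose[OF k(2) dX XS] k(1) by (simp add: v_def)
    ultimately show "\<exists>f'. (\<exists>k. smooth {a..b} k \<and> f' = (\<lambda>s. k (X s))) \<and> deriv_on {h a..h b} f f'"
      by (intro exI[of _ "\<lambda>s. k' (X s) * inverse (h' (X s))"]) (auto intro!: exI[of _ "\<lambda>x. k' x * inverse (h' x)"])
  qed (use that in auto)
  have "smooth {h a..h b} v"
    unfolding v_def using pos by (intro sv smooth_inverse assms) (auto simp: less_imp_neq[symmetric])
  moreover have "v s > 0" if "s \<in> {h a..h b}" for s
    using pos XS that by (simp add: v_def image_subset_iff)
  ultimately show thesis
    using dX X range by (intro that[of X v]) (auto simp: v_def)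
qed

text \<open>Extending \<open>ln v\<close> instead of \<open>v\<close> keeps the extension \<open>V\<close> of \<open>v\<close> positive. Its antiderivative \<open>Y\<close>
  extends \<open>X\<close>; writing \<open>Y s = s * q s\<close>, the function \<open>\<phi> = 1 / q\<close> satisfies
  \<open>\<phi> - s * \<phi>' = (q + s * q') / q\<^sup>2 = V / q\<^sup>2 > 0\<close>.\<close>
lemma deformation_function_exists:
  assumes "a \<le> 0" "0 \<le> b" "a < b" "deriv_on {a..b} X v" "smooth {a..b} v"
    and pos: "\<And>s. s \<in> {a..b} \<Longrightarrow> v s > 0"
    and "X 0 = 0" "d > 0" "{a..b} \<subseteq> {-d..d}"
  obtains \<phi> \<phi>' where "smooth {-d..d} \<phi>" "deriv_on {-d..d} \<phi> \<phi>'"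
    "\<And>s. s \<in> {-d..d} \<Longrightarrow> \<phi> s > 0" "\<And>s. s \<in> {-d..d} \<Longrightarrow> \<phi> s - s * \<phi>' s > 0"
    "\<And>s. s \<in> {a..b} \<Longrightarrow> s = X s * \<phi> s" "\<phi> 0 = inverse (v 0)"
proof -
  \<comment> \<open>an extension by \<open>2 * d\<close> on either side covers \<open>{-d..d}\<close>, because \<open>{a..b}\<close> lies in it\<close>
  obtain w where w: "smooth {a - 2 * d..b + 2 * d} w" "\<And>s. s \<in> {a..b} \<Longrightarrow> w s = ln (v s)"
    using smooth_extend[OF smooth_ln[OF assms(5) pos], of "2 * d"] assms by auto
  define V where "V s = exp (w s)" for s
  have w': "smooth {-d..d} w" by (rule smooth_subset[OF w(1)]) (use assms in auto)
  have V: "smooth {-d..d} V" unfolding V_def by (rule smooth_compose[OF smooth_exp w', of UNIV]) auto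
  have Vv: "V s = v s" if "s \<in> {a..b}" for s using w(2)[OF that] pos[OF that] by (simp add: V_def)
  obtain Y where Y: "deriv_on {-d..d} Y V" "smooth {-d..d} Y" "Y 0 = 0"
    using smooth_antiderivative[OF V, of 0] assms by auto
  have YX: "Y s = X s" if "s \<in> {a..b}" for s
  proof (rule deriv_on_unique_const[of "{a..b}" Y v X 0])
    show "deriv_on {a..b} Y v"
      using deriv_on_subset[OF Y(1) assms(9)] deriv_on_cong[of "{a..b}" Y Y V v] Vv by simp
  qed (use that assms Y in auto)
  obtain q where q: "smooth {-d..d} q" "\<And>s. s \<in> {-d..d} \<Longrightarrow> Y s = (s - 0) * q s" "q 0 = V 0"
    by (rule hadamard_quotient[OF Y(2,1) _ _ Y(3)]) (use assms in auto)
  have qpos: "q s > 0" if s: "s \<in> {-d..d}" for s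
  proof -
    note mono = deriv_on_pos_imp_strict_mono[OF Y(1)]
    have Vpos: "V s > 0" for s by (simp add: V_def)
    consider "s = 0" | "s > 0" | "s < 0" by linarith
    then show ?thesis
    proof cases
      case 1 then show ?thesis using q(3) Vpos by simp
    next
      case 2 then have "Y 0 < Y s" using mono[of 0 s] Vpos s by auto
      then show ?thesis using q(2)[OF s] Y(3) 2 by (simp add: zero_less_mult_iff)
    next
      case 3 then have "Y s < Y 0" using mono[of s 0] Vpos s by auto
      then show ?thesis using q(2)[OF s] Y(3) 3 by (simp add: mult_less_0_iff)
    qed
  qed
  obtain q' where q': "deriv_on {-d..d} q q'" using q(1) by (rule smooth_deriv)
  have YV: "V s = q s + s * q' s" if s: "s \<in> {-d..d}" for s
  proof -
    have "deriv_on {-d..d} (\<lambda>s. s * q s) (\<lambda>s. q s + s * q' s)"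
      using q' by (auto simp: deriv_on_def intro!: derivative_eq_intros)
    then have "deriv_on {-d..d} Y (\<lambda>s. q s + s * q' s)"
      using q(2) deriv_on_cong[of "{-d..d}" Y "\<lambda>s. s * q s" "\<lambda>s. q s + s * q' s" "\<lambda>s. q s + s * q' s"] by simp
    then have "(Y has_vector_derivative q s + s * q' s) (at s within {-d..d})"
      "(Y has_vector_derivative V s) (at s within {-d..d})"
      using s Y(1) by (auto simp: deriv_on_def has_real_derivative_iff_has_vector_derivative)
    then show ?thesis
      using vector_derivative_unique_within_closed_interval[of "-d" d s Y] s assms(8) by simp
  qed
  define \<phi> where "\<phi> s = inverse (q s)" for s
  define \<phi>' where "\<phi>' s = - q' s * (inverse (q s) * inverse (q s))" for s
  have d\<phi>: "deriv_on {-d..d} \<phi> \<phi>'"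
    unfolding \<phi>_def \<phi>'_def using q' qpos
    by (auto simp: deriv_on_def less_imp_neq[symmetric] intro!: derivative_eq_intros)
  have "smooth {-d..d} \<phi>"
    unfolding \<phi>_def using q(1) qpos by (intro smooth_inverse) (auto simp: less_imp_neq[symmetric])
  moreover note d\<phi>
  moreover have "\<phi> s > 0" if "s \<in> {-d..d}" for s using qpos[OF that] by (simp add: \<phi>_def)
  moreover have "\<phi> s - s * \<phi>' s > 0" if "s \<in> {-d..d}" for s
  proof -
    have "\<phi> s - s * \<phi>' s = V s * (inverse (q s) * inverse (q s))"
      using qpos[OF that] YV[OF that] by (simp add: \<phi>_def \<phi>'_def field_simps)
    then show ?thesis using qpos[OF that] by (simp add: V_def)
  qed
  moreover have "s = X s * \<phi> s" if "s \<in> {a..b}" for s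
    using YX[OF that] q(2)[of s] qpos[of s] that assms(9) by (auto simp: \<phi>_def subset_iff)
  moreover have "\<phi> 0 = inverse (v 0)" using q(3) Vv[of 0] assms by (simp add: \<phi>_def)
  ultimately show thesis by (rule that)
qed

section \<open>Minkowski norms and their partial derivatives\<close>

text \<open>The derivative is taken within the punctured space, so that iterating it reproduces the
  derivatives in the definition of smoothness away from the origin.\<close>
definition partial :: "'a::real_normed_vector \<Rightarrow> ('a \<Rightarrow> real) \<Rightarrow> 'a \<Rightarrow> real" where
  "partial v G x = frechet_derivative G (at x within - {0}) v"

lemma smooth_on_partial: "smooth_on (- {0}) G \<Longrightarrow> smooth_on (- {0}) (partial v G)"
  unfolding smooth_on_def partial_def[abs_def] by (metis k_smooth_on.simps(2))

lemma smooth_on_has_derivative: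
  assumes "smooth_on (- {0}) G" "x \<noteq> 0"
  shows "(G has_derivative (\<lambda>v. partial v G x)) (at x)"
proof -
  have "k_smooth_on (Suc 0) (- {0}) G" using assms(1) unfolding smooth_on_def by blast
  then have "G differentiable (at x within - {0})"
    using assms(2) by (simp add: differentiable_on_def)
  then have "(G has_derivative (\<lambda>v. partial v G x)) (at x within - {0})"
    unfolding partial_def frechet_derivative_works .
  then show ?thesis using assms(2) at_within_open[of x "- {0}"] by (simp add: open_Compl)
qed

lemma partial_linear:
  assumes "smooth_on (- {0}) G" "x \<noteq> 0"
  shows "partial (v + w) G x = partial v G x + partial w G x" "partial (c *\<^sub>R v) G x = c * partial v G x"
  using linear_add[OF has_derivative_linear[OF smooth_on_has_derivative[OF assms]], of v w]
    linear_cmul[OF has_derivative_linear[OF smooth_on_has_derivative[OF assms]], of c v] by simp_all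

lemma smooth_on_line_derivative:
  assumes "smooth_on (- {0}) G" "x + t *\<^sub>R v \<noteq> 0"
  shows "((\<lambda>t. G (x + t *\<^sub>R v)) has_real_derivative partial v G (x + t *\<^sub>R v)) (at t)"
proof -
  have "((\<lambda>t. x + t *\<^sub>R v) has_derivative (\<lambda>h. h *\<^sub>R v)) (at t)"
    by (auto intro!: derivative_eq_intros)
  from has_derivative_compose[OF this smooth_on_has_derivative[OF assms]]
  show ?thesis
    by (rule has_derivative_imp_has_field_derivative) (simp add: partial_linear(2)[OF assms])
qed

text \<open>The derivative of \<open>G\<close> along the circle is a combination of its partial derivatives in the fixed
  directions \<open>a\<close> and \<open>b\<close> with trigonometric coefficients, so the restrictions of smooth functions to the
  circle are closed under derivatives up to sums and products.\<close>
lemma smooth_on_circle: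
  assumes "smooth_on (- {0}) G" "\<And>t. cos t *\<^sub>R a + sin t *\<^sub>R b \<noteq> 0"
  shows "deriv_on S (\<lambda>t. G (cos t *\<^sub>R a + sin t *\<^sub>R b))
    (\<lambda>t. cos t * partial b G (cos t *\<^sub>R a + sin t *\<^sub>R b) - sin t * partial a G (cos t *\<^sub>R a + sin t *\<^sub>R b))" (is ?D)
    and "smooth S (\<lambda>t. G (cos t *\<^sub>R a + sin t *\<^sub>R b))"
proof -
  let ?c = "\<lambda>t. cos t *\<^sub>R a + sin t *\<^sub>R b"
  have D: "deriv_on S (\<lambda>t. G (?c t)) (\<lambda>t. cos t * partial b G (?c t) - sin t * partial a G (?c t))"
    if "smooth_on (- {0}) G" for G
    unfolding deriv_on_def
  proof
    fix t
    have "(?c has_derivative (\<lambda>h. (h * cos t) *\<^sub>R b + (h * - sin t) *\<^sub>R a)) (at t)"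
      by (auto intro!: derivative_eq_intros simp: algebra_simps)
    note has_derivative_compose[OF this smooth_on_has_derivative[OF that assms(2)]]
    moreover have "(\<lambda>h. partial ((h * cos t) *\<^sub>R b + (h * - sin t) *\<^sub>R a) G (?c t))
        = (*) (cos t * partial b G (?c t) - sin t * partial a G (?c t))"
      unfolding partial_linear[OF that assms(2)] by (simp add: fun_eq_iff algebra_simps)
    ultimately have "((\<lambda>t. G (?c t)) has_real_derivative cos t * partial b G (?c t) - sin t * partial a G (?c t)) (at t)"
      unfolding has_field_derivative_def by simp
    then show "((\<lambda>t. G (?c t)) has_real_derivative cos t * partial b G (?c t) - sin t * partial a G (?c t)) (at t within S)"
      by (rule has_field_derivative_at_within)
  qed
  show ?D by (rule D[OF assms(1)])
  define P where "P f \<longleftrightarrow> (\<exists>G. smooth_on (- {0}) G \<and> f = (\<lambda>t. G (?c t)))" for f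
  show "smooth S (\<lambda>t. G (?c t))"
  proof (rule smooth_upto_algebra[of P])
    fix f assume "P f"
    then obtain G where G: "smooth_on (- {0}) G" "f = (\<lambda>t. G (?c t))" by (auto simp: P_def)
    have PG: "P (\<lambda>t. partial v G (?c t))" for v
      unfolding P_def using smooth_on_partial[OF G(1)] by blast
    have "algebra_over S P (\<lambda>t. cos t * partial b G (?c t) + (- sin t) * partial a G (?c t))"
      using PG by (intro algebra_over.add algebra_over.mult)
        (auto intro: algebra_over.generator algebra_over.smooth smooth_sin_cos smooth_minus)
    then show "\<exists>f'. algebra_over S P f' \<and> deriv_on S f f'"
      using D[OF G(1)] G(2) by auto
  qed (use assms in \<open>auto simp: P_def\<close>)
qed

lemma fundamental_form_diagonal:
  assumes "smooth_on (- {0}) F" "y \<noteq> 0"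
  shows "fundamental_form F y u u = F y * partial u (partial u F) y + (partial u F y)\<^sup>2"
proof -
  have inner: "deriv (\<lambda>t. (F (y + s *\<^sub>R u + t *\<^sub>R u))\<^sup>2) 0 = 2 * F (y + s *\<^sub>R u) * partial u F (y + s *\<^sub>R u)"
    if "y + s *\<^sub>R u \<noteq> 0" for s
  proof (rule DERIV_imp_deriv)
    show "((\<lambda>t. (F (y + s *\<^sub>R u + t *\<^sub>R u))\<^sup>2) has_real_derivative 2 * F (y + s *\<^sub>R u) * partial u F (y + s *\<^sub>R u)) (at 0)"
      using DERIV_power[OF smooth_on_line_derivative[OF assms(1), of "y + s *\<^sub>R u" 0 u], of 2] that
      by (simp add: ac_simps)
  qed
  have "open {s. y + s *\<^sub>R u \<noteq> 0}"
    by (intro open_Collect_neq continuous_intros)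
  then have "eventually (\<lambda>s. y + s *\<^sub>R u \<noteq> 0) (nhds 0)"
    using eventually_nhds_in_open[of "{s. y + s *\<^sub>R u \<noteq> 0}" 0] assms(2) by simp
  then have "eventually (\<lambda>s. deriv (\<lambda>t. (F (y + s *\<^sub>R u + t *\<^sub>R u))\<^sup>2) 0
      = 2 * F (y + s *\<^sub>R u) * partial u F (y + s *\<^sub>R u)) (nhds 0)"
    by (rule eventually_mono) (rule inner)
  then have "deriv (\<lambda>s. deriv (\<lambda>t. (F (y + s *\<^sub>R u + t *\<^sub>R u))\<^sup>2) 0) 0
      = deriv (\<lambda>s. 2 * F (y + s *\<^sub>R u) * partial u F (y + s *\<^sub>R u)) 0"
    by (rule deriv_cong_ev) simp
  also have "\<dots> = 2 * (F y * partial u (partial u F) y + (partial u F y)\<^sup>2)"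
  proof (rule DERIV_imp_deriv)
    have nz: "y + 0 *\<^sub>R u \<noteq> 0" using assms(2) by simp
    from DERIV_mult[OF DERIV_cmult[OF smooth_on_line_derivative[OF assms(1) nz], of 2]
        smooth_on_line_derivative[OF smooth_on_partial[OF assms(1)] nz, of u]]
    show "((\<lambda>s. 2 * F (y + s *\<^sub>R u) * partial u F (y + s *\<^sub>R u)) has_real_derivative
        2 * (F y * partial u (partial u F) y + (partial u F y)\<^sup>2)) (at 0)"
      by (rule DERIV_cong) (simp add: power2_eq_square distrib_left)
  qed
  finally show ?thesis unfolding fundamental_form_def by simp
qed

lemma minkowski_normD:
  assumes "minkowski_norm F"
  shows "F y \<ge> 0" "smooth_on (- {0}) F" "l > 0 \<Longrightarrow> F (l *\<^sub>R y) = l * F y"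
    "y \<noteq> 0 \<Longrightarrow> u \<noteq> 0 \<Longrightarrow> F y * partial u (partial u F) y + (partial u F y)\<^sup>2 > 0"
proof -
  show sm: "smooth_on (- {0}) F" and "F y \<ge> 0" "l > 0 \<Longrightarrow> F (l *\<^sub>R y) = l * F y"
    using assms unfolding minkowski_norm_def by blast+
  assume "y \<noteq> 0" "u \<noteq> 0"
  then show "F y * partial u (partial u F) y + (partial u F y)\<^sup>2 > 0"
    using assms fundamental_form_diagonal[OF sm, of y u] unfolding minkowski_norm_def by metis
qed

lemma minkowski_norm_0: assumes "minkowski_norm F" shows "F 0 = 0"
  using minkowski_normD(3)[OF assms, of 2 0] by simp

text \<open>A zero of \<open>F\<close> away from the origin would be a minimum, so all first derivatives would vanish there
  and the fundamental form would be degenerate.\<close>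
lemma minkowski_norm_pos:
  assumes F: "minkowski_norm F" and "y \<noteq> 0"
  shows "F y > 0"
proof (rule ccontr)
  assume "\<not> F y > 0"
  then have 0: "F y = 0" using minkowski_normD(1)[OF F, of y] by simp
  have "(\<lambda>v. partial v F y) = (\<lambda>v. 0)"
    using 0 minkowski_normD(1)[OF F] smooth_on_has_derivative[OF minkowski_normD(2)[OF F] assms(2)]
    by (intro differential_zero_maxmin[of y UNIV F]) auto
  then have "partial y F y = 0" by meson
  with minkowski_normD(4)[OF F assms(2,2)] 0 show False by simp
qed

lemma minkowski_norm_euler:
  assumes F: "minkowski_norm F" and "y \<noteq> 0"
  shows "partial y F y = F y"
proof -
  note sm = minkowski_normD(2)[OF F]
  have "((\<lambda>t. F (y + t *\<^sub>R y)) has_real_derivative partial y F y) (at 0)"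
    using smooth_on_line_derivative[OF sm, of y 0 y] assms(2) by simp
  moreover have "((\<lambda>t. (1 + t) * F y) has_real_derivative F y) (at 0)"
    by (auto intro!: derivative_eq_intros)
  then have "((\<lambda>t. F (y + t *\<^sub>R y)) has_real_derivative F y) (at 0)"
  proof (rule has_field_derivative_transform_within_open[of _ _ _ "{-1<..}"])
    fix t :: real assume "t \<in> {-1<..}"
    then show "(1 + t) * F y = F (y + t *\<^sub>R y)"
      using minkowski_normD(3)[OF F, of "1 + t" y] by (simp add: scaleR_add_left)
  qed auto
  ultimately show ?thesis by (rule DERIV_unique)
qed

lemma reflection_in_line_linear_involution:
  assumes "e \<noteq> 0"
  shows "reflection_in_line e (reflection_in_line e y) = y"
    "reflection_in_line e (c *\<^sub>R y) = c *\<^sub>R reflection_in_line e y"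
  using assms by (simp_all add: reflection_in_line_def inner_diff_left algebra_simps scaleR_diff_right
      flip: scaleR_2)

text \<open>By homogeneity \<open>F\<close> is determined by its unit ball, so invariance of the ball gives \<open>F \<circ> R \<le> F\<close>;
  the converse inequality holds because the reflection is an involution.\<close>
lemma minkowski_norm_reflection_invariant:
  assumes F: "minkowski_norm F" and e: "e \<noteq> 0" "reflection_in_line e ` convex_body F = convex_body F"
  shows "F (reflection_in_line e y) = F y"
proof -
  let ?R = "reflection_in_line e"
  note R = reflection_in_line_linear_involution[OF e(1)]
  have le: "F (?R y) \<le> F y" for y
  proof (cases "y = 0")
    case True then show ?thesis using R(2)[of 0 0] by simp
  next
    case False
    define c where "c = F y"
    have c: "c > 0" using minkowski_norm_pos[OF F False] by (simp add: c_def)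
    have "F (inverse c *\<^sub>R y) = 1" using c minkowski_normD(3)[OF F, of "inverse c" y] by (simp add: c_def)
    then have "?R (inverse c *\<^sub>R y) \<in> convex_body F" using e(2) by (auto simp: convex_body_def)
    then have "inverse c * F (?R y) \<le> 1"
      using c minkowski_normD(3)[OF F, of "inverse c" "?R y"] by (simp add: convex_body_def R(2))
    then show ?thesis using c by (simp add: c_def field_simps)
  qed
  from le[of y] le[of "?R y"] show ?thesis by (simp add: R(1))
qed

section \<open>Axisymmetric Minkowski norms in the plane\<close>

definition quarter_turn :: "real^2 \<Rightarrow> real^2" where
  "quarter_turn e = vector [- (e $ 2), e $ 1]"

lemma quarter_turn_orthonormal:
  assumes "norm e = 1"
  shows "e \<bullet> e = 1" "quarter_turn e \<bullet> quarter_turn e = 1" "e \<bullet> quarter_turn e = 0" "quarter_turn e \<bullet> e = 0"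
proof -
  show "e \<bullet> e = 1" using assms by (simp add: norm_eq_1)
  then show "quarter_turn e \<bullet> quarter_turn e = 1" "e \<bullet> quarter_turn e = 0" "quarter_turn e \<bullet> e = 0"
    by (simp_all add: inner_vec_def sum_2 quarter_turn_def vector_2)
qed

lemma plane_coordinates:
  assumes "norm e = 1"
  shows "y = (y \<bullet> e) *\<^sub>R e + (y \<bullet> quarter_turn e) *\<^sub>R quarter_turn e"
proof -
  have *: "e $ 1 * e $ 1 + e $ 2 * e $ 2 = 1"
    using quarter_turn_orthonormal(1)[OF assms] by (simp add: inner_vec_def sum_2)
  have "(y $ 1 * e $ 1 + y $ 2 * e $ 2) * e $ 1 + (y $ 2 * e $ 1 - y $ 1 * e $ 2) * - (e $ 2)
      = y $ 1 * (e $ 1 * e $ 1 + e $ 2 * e $ 2)"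
    "(y $ 1 * e $ 1 + y $ 2 * e $ 2) * e $ 2 + (y $ 2 * e $ 1 - y $ 1 * e $ 2) * e $ 1
      = y $ 2 * (e $ 1 * e $ 1 + e $ 2 * e $ 2)"
    by (simp_all add: algebra_simps)
  then show ?thesis
    unfolding * by (simp add: vec_eq_iff forall_2 inner_vec_def sum_2 quarter_turn_def vector_2)
qed

lemma plane_norm:
  assumes "norm e = 1"
  shows "(norm y)\<^sup>2 = (y \<bullet> e)\<^sup>2 + (y \<bullet> quarter_turn e)\<^sup>2"
proof -
  let ?q = "quarter_turn e"
  have "(norm y)\<^sup>2 = y \<bullet> ((y \<bullet> e) *\<^sub>R e + (y \<bullet> ?q) *\<^sub>R ?q)"
    unfolding plane_coordinates[OF assms, symmetric] by (simp add: dot_square_norm)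
  then show ?thesis by (simp add: inner_add_right power2_eq_square)
qed

lemma reflection_in_line_coordinates:
  assumes "norm e = 1"
  shows "reflection_in_line e (a *\<^sub>R e + b *\<^sub>R quarter_turn e) = a *\<^sub>R e - b *\<^sub>R quarter_turn e"
proof -
  have "((a *\<^sub>R e + b *\<^sub>R quarter_turn e) \<bullet> e) / (e \<bullet> e) = a"
    by (simp add: inner_add_left quarter_turn_orthonormal[OF assms])
  then have "reflection_in_line e (a *\<^sub>R e + b *\<^sub>R quarter_turn e)
      = (a + a) *\<^sub>R e - (a *\<^sub>R e + b *\<^sub>R quarter_turn e)"
    by (simp add: reflection_in_line_def)
  then show ?thesis by (simp only: scaleR_add_left) simp
qed

lemma coordinates_nonzero:
  assumes "norm e = 1" "a \<noteq> 0 \<or> b \<noteq> 0"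
  shows "a *\<^sub>R e + b *\<^sub>R quarter_turn e \<noteq> 0"
proof
  assume 0: "a *\<^sub>R e + b *\<^sub>R quarter_turn e = 0"
  have "(a *\<^sub>R e + b *\<^sub>R quarter_turn e) \<bullet> e = a" "(a *\<^sub>R e + b *\<^sub>R quarter_turn e) \<bullet> quarter_turn e = b"
    by (simp_all add: inner_add_left quarter_turn_orthonormal[OF assms(1)])
  with assms(2) show False unfolding 0 by simp
qed

text \<open>Normal to the axis, \<open>F\<close> is an even function.\<close>
lemma partial_normal_axis:
  assumes F: "minkowski_norm F" and e: "norm e = 1"
    and sym: "\<And>a b. F (a *\<^sub>R e - b *\<^sub>R quarter_turn e) = F (a *\<^sub>R e + b *\<^sub>R quarter_turn e)"
    and "a \<noteq> 0"
  shows "partial (quarter_turn e) F (a *\<^sub>R e) = 0"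
proof -
  let ?q = "quarter_turn e"
  have "((\<lambda>s. F (a *\<^sub>R e + s *\<^sub>R ?q)) has_real_derivative partial ?q F (a *\<^sub>R e)) (at 0)"
    using smooth_on_line_derivative[OF minkowski_normD(2)[OF F] coordinates_nonzero[OF e, of a 0]] \<open>a \<noteq> 0\<close>
    by simp
  moreover from DERIV_mirror[of "\<lambda>s. F (a *\<^sub>R e + s *\<^sub>R ?q)" "partial ?q F (a *\<^sub>R e)" 0] this
  have "((\<lambda>s. F (a *\<^sub>R e + s *\<^sub>R ?q)) has_real_derivative - partial ?q F (a *\<^sub>R e)) (at 0)"
    by (simp add: sym)
  ultimately have "partial ?q F (a *\<^sub>R e) = - partial ?q F (a *\<^sub>R e)" by (rule DERIV_unique)
  then show ?thesis by simp
qed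

text \<open>Along a line normal to the axis, half the derivative of \<open>F\<^sup>2\<close> is \<open>F * \<partial>F\<close>, which vanishes on the
  axis by symmetry and is strictly increasing by positivity of the fundamental form. The line through
  the origin has to be treated separately, because \<open>F\<close> is not smooth there; on it Euler's relation
  gives the claim.\<close>
lemma partial_normal_pos:
  assumes F: "minkowski_norm F" and e: "norm e = 1"
    and sym: "\<And>a b. F (a *\<^sub>R e - b *\<^sub>R quarter_turn e) = F (a *\<^sub>R e + b *\<^sub>R quarter_turn e)"
    and "b > 0"
  shows "partial (quarter_turn e) F (a *\<^sub>R e + b *\<^sub>R quarter_turn e) > 0"
proof (cases "a = 0")
  case True
  let ?q = "quarter_turn e"
  have nz: "b *\<^sub>R ?q \<noteq> 0" using coordinates_nonzero[OF e, of 0 b] \<open>b > 0\<close> by simp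
  have "b * partial ?q F (b *\<^sub>R ?q) = F (b *\<^sub>R ?q)"
    using partial_linear(2)[OF minkowski_normD(2)[OF F] nz, of b ?q] minkowski_norm_euler[OF F nz] by simp
  then have "b * partial ?q F (b *\<^sub>R ?q) > 0" using minkowski_norm_pos[OF F nz] by simp
  then show ?thesis using True \<open>b > 0\<close> by (simp add: zero_less_mult_iff)
next
  case False
  let ?q = "quarter_turn e"
  let ?y = "\<lambda>s. a *\<^sub>R e + s *\<^sub>R ?q"
  note sm = minkowski_normD(2)[OF F]
  have nz: "?y s \<noteq> 0" for s using coordinates_nonzero[OF e] False by blast
  have q: "?q \<noteq> 0" using quarter_turn_orthonormal(2)[OF e] by auto
  have "F (?y 0) * partial ?q F (?y 0) < F (?y b) * partial ?q F (?y b)"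
  proof (rule DERIV_pos_imp_increasing[OF \<open>b > 0\<close>])
    fix s
    have "((\<lambda>s. F (?y s) * partial ?q F (?y s)) has_real_derivative
        partial ?q F (?y s) * partial ?q F (?y s) + partial ?q (partial ?q F) (?y s) * F (?y s)) (at s)"
      by (rule DERIV_mult[OF smooth_on_line_derivative[OF sm nz]
            smooth_on_line_derivative[OF smooth_on_partial[OF sm] nz]])
    moreover have "partial ?q F (?y s) * partial ?q F (?y s) + partial ?q (partial ?q F) (?y s) * F (?y s) > 0"
      using minkowski_normD(4)[OF F nz q] by (simp add: power2_eq_square algebra_simps)
    ultimately show "\<exists>d. ((\<lambda>s. F (?y s) * partial ?q F (?y s)) has_real_derivative d) (at s) \<and> d > 0"
      by blast
  qed
  moreover have "partial ?q F (?y 0) = 0"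
    using partial_normal_axis[OF F e sym False] by simp
  ultimately have "F (?y b) * partial ?q F (?y b) > 0" by simp
  then show ?thesis by (rule zero_less_mult_pos[OF _ minkowski_norm_pos[OF F nz]])
qed

text \<open>In terms of the angle \<open>t\<close> and with \<open>f' = - sin * n\<close>, Euler's relation turns the derivative of \<open>F\<close> normal
  to the axis into \<open>sin t * (f t - cos t * n t)\<close>. Away from the axis the second factor is positive
  because this product and the sine are. On the axis, where both sides vanish, comparing their
  derivatives with respect to \<open>t\<close> identifies the factor with the second normal derivative of \<open>F\<close>, which
  is positive because the fundamental form is positive and the first normal derivative is zero.\<close>
lemma profile_function:
  assumes F: "minkowski_norm F" and e: "norm e = 1"
    and sym: "\<And>a b. F (a *\<^sub>R e - b *\<^sub>R quarter_turn e) = F (a *\<^sub>R e + b *\<^sub>R quarter_turn e)"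
  obtains g g' where "smooth {-1..1} g" "smooth {-1..1} g'" "deriv_on {-1..1} g g'"
    "\<And>x. x \<in> {-1..1} \<Longrightarrow> g x > 0" "\<And>x. x \<in> {-1..1} \<Longrightarrow> g x - x * g' x > 0"
    "\<And>y. y \<noteq> 0 \<Longrightarrow> F y = norm y * g ((y \<bullet> e) / norm y)"
proof -
  define q where "q = quarter_turn e"
  note sm = minkowski_normD(2)[OF F]
  define c where "c t = cos t *\<^sub>R e + sin t *\<^sub>R q" for t
  define f where "f t = F (c t)" for t
  have nz': "cos t *\<^sub>R e + sin t *\<^sub>R q \<noteq> 0" for t
  proof -
    have "cos t \<noteq> 0 \<or> sin t \<noteq> 0" using sin_cos_squared_add[of t] by (auto simp: power2_eq_square)
    then show ?thesis unfolding q_def by (rule coordinates_nonzero[OF e])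
  qed
  then have nz: "c t \<noteq> 0" for t by (simp add: c_def)
  have op: "open strip" by (simp add: strip_def)
  have f: "smooth strip f"
    using smooth_on_circle(2)[OF sm nz', of strip] by (simp add: f_def[abs_def] c_def)
  have "doubly_even f"
    using sym by (auto simp: doubly_even_def f_def c_def q_def)
  then obtain n where n: "smooth strip n" "doubly_even n" "deriv_on strip f (\<lambda>t. - sin t * n t)"
      "deriv_on {-1..1} (\<lambda>x. f (arccos x)) (\<lambda>x. n (arccos x))"
    by (rule doubly_even_deriv[OF f])
  have fq: "partial q F (c t) = sin t * (f t - cos t * n t)" if t: "t \<in> strip" for t
  proof -
    have "deriv_on strip f (\<lambda>t. cos t * partial q F (c t) - sin t * partial e F (c t))"
      using smooth_on_circle(1)[OF sm nz', of strip] by (simp add: f_def[abs_def] c_def)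
    from DERIV_unique[OF deriv_on_openD[OF this op t] deriv_on_openD[OF n(3) op t]]
    have 1: "- sin t * n t = cos t * partial q F (c t) - sin t * partial e F (c t)" by simp
    have 2: "f t = cos t * partial e F (c t) + sin t * partial q F (c t)"
      using minkowski_norm_euler[OF F nz, of t] partial_linear[OF sm nz]
      by (simp add: f_def) (simp add: c_def partial_linear[OF sm nz'])
    have "sin t * (f t - cos t * n t) = sin t * f t + cos t * (- sin t * n t)"
      by (simp add: algebra_simps)
    also have "\<dots> = ((sin t)\<^sup>2 + (cos t)\<^sup>2) * partial q F (c t)"
      unfolding 1 2 by algebra
    finally show ?thesis by (simp only: sin_cos_squared_add mult_1_left)
  qed
  have N: "f t - cos t * n t > 0" if t: "t \<in> {0..pi}" for t
  proof -
    have ts: "t \<in> strip"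
      using t pi_gt_zero unfolding strip_def atLeastAtMost_iff greaterThanLessThan_iff by linarith
    show ?thesis
    proof (cases "sin t = 0")
      case False
      then have "t \<noteq> 0" "t \<noteq> pi" by auto
      then have "sin t > 0" using t by (intro sin_gt_zero) auto
      moreover have "partial q F (c t) > 0"
        unfolding c_def q_def by (rule partial_normal_pos[OF F e sym \<open>sin t > 0\<close>])
      ultimately show ?thesis using fq[OF ts] by (simp add: zero_less_mult_iff)
    next
      case True
      have ct: "cos t \<noteq> 0" using True sin_cos_squared_add[of t] by auto
      have c_t: "c t = cos t *\<^sub>R e" using True by (simp add: c_def)
      obtain n' where n': "deriv_on strip n n'" using n(1) by (rule smooth_deriv)
      have "((\<lambda>t. f t - cos t * n t) has_real_derivative - sin t * n t - (- sin t * n t + n' t * cos t)) (at t)"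
        by (intro DERIV_diff DERIV_mult DERIV_cos deriv_on_openD[OF n(3) op ts] deriv_on_openD[OF n' op ts])
      from DERIV_mult[OF DERIV_sin this]
      have "((\<lambda>t. sin t * (f t - cos t * n t)) has_real_derivative cos t * (f t - cos t * n t)) (at t)"
        using True by simp
      then have "((\<lambda>t. partial q F (c t)) has_real_derivative cos t * (f t - cos t * n t)) (at t)"
        by (rule has_field_derivative_transform_within_open[OF _ op ts]) (simp add: fq)
      moreover have "((\<lambda>t. partial q F (c t)) has_real_derivative cos t * partial q (partial q F) (c t)) (at t)"
        using smooth_on_circle(1)[OF smooth_on_partial[OF sm] nz', of strip q, THEN deriv_on_openD, OF op ts] True
        by (simp add: c_def)
      ultimately have "cos t * (f t - cos t * n t) = cos t * partial q (partial q F) (c t)"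
        by (rule DERIV_unique)
      then have eq: "f t - cos t * n t = partial q (partial q F) (c t)" using ct by simp
      have "q \<noteq> 0" using quarter_turn_orthonormal(2)[OF e] by (auto simp: q_def)
      moreover have "partial q F (c t) = 0"
        unfolding c_t q_def by (rule partial_normal_axis[OF F e sym ct])
      ultimately have "F (c t) * partial q (partial q F) (c t) > 0"
        using minkowski_normD(4)[OF F nz[of t], of q] by simp
      then show ?thesis
        unfolding eq by (rule zero_less_mult_pos[OF _ minkowski_norm_pos[OF F nz]])
    qed
  qed
  show thesis
  proof (rule that[of "\<lambda>x. f (arccos x)" "\<lambda>x. n (arccos x)"])
    show "smooth {-1..1} (\<lambda>x. f (arccos x))" by (rule smooth_doubly_even_arccos[OF f \<open>doubly_even f\<close>])
    show "smooth {-1..1} (\<lambda>x. n (arccos x))" by (rule smooth_doubly_even_arccos[OF n(1,2)])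
    show "f (arccos x) > 0" for x unfolding f_def by (rule minkowski_norm_pos[OF F nz])
    show "f (arccos x) - x * n (arccos x) > 0" if "x \<in> {-1..1}" for x
      using N[of "arccos x"] that by (simp add: arccos_lbound arccos_ubound)
    fix y :: "real^2" assume "y \<noteq> 0"
    define r where "r = norm y"
    have r: "r > 0" using \<open>y \<noteq> 0\<close> by (simp add: r_def)
    define x where "x = (y \<bullet> e) / r"
    define z where "z = (y \<bullet> q) / r"
    have xz: "x\<^sup>2 + z\<^sup>2 = 1"
    proof -
      have "x\<^sup>2 + z\<^sup>2 = ((y \<bullet> e)\<^sup>2 + (y \<bullet> q)\<^sup>2) / r\<^sup>2"
        by (simp add: x_def z_def power_divide add_divide_distrib)
      also have "\<dots> = r\<^sup>2 / r\<^sup>2" by (simp only: plane_norm[OF e, of y] r_def q_def)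
      finally show ?thesis using r by simp
    qed
    then have "x\<^sup>2 \<le> 1" using zero_le_power2[of z] by linarith
    then have x1: "-1 \<le> x" "x \<le> 1" by (auto simp: abs_square_le_1)
    have "sqrt (1 - x\<^sup>2) = \<bar>z\<bar>" using xz by (metis add_diff_cancel_left' real_sqrt_abs)
    then have c_x: "c (arccos x) = x *\<^sub>R e + \<bar>z\<bar> *\<^sub>R q"
      using x1 by (simp add: c_def sin_arccos)
    have "r *\<^sub>R (x *\<^sub>R e + z *\<^sub>R q) = (y \<bullet> e) *\<^sub>R e + (y \<bullet> q) *\<^sub>R q"
      using r by (simp add: x_def z_def scaleR_add_right)
    also have "\<dots> = y" unfolding q_def by (rule plane_coordinates[OF e, symmetric])
    finally have "F y = r * F (x *\<^sub>R e + z *\<^sub>R q)" using minkowski_normD(3)[OF F r] by metis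
    also have "F (x *\<^sub>R e + z *\<^sub>R q) = f (arccos x)"
      unfolding f_def c_x using sym[of x z] by (cases "z \<ge> 0") (auto simp: q_def)
    finally show "F y = norm y * f (arccos ((y \<bullet> e) / norm y))" by (simp add: r_def x_def)
  qed (rule n(4))
qed

theorem mainTheorem5:
  fixes F :: "real^2 \<Rightarrow> real"
  assumes "minkowski_norm F"
    and "axisymmetric (convex_body F)"
  shows "\<exists>\<beta> \<delta> \<phi>. deformation_data F \<beta> \<delta> \<phi> \<and>
           deform \<beta> \<phi> F = norm \<and>
           convex_body (deform \<beta> \<phi> F) = cball 0 1"
proof -
  note F = assms(1)
  obtain e0 where e0: "e0 \<noteq> 0" "reflection_in_line e0 ` convex_body F = convex_body F"
    using assms(2) by (auto simp: axisymmetric_def)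
  define e where "e = sgn e0"
  have e: "norm e = 1" "e \<noteq> 0" using e0(1) by (auto simp: e_def norm_sgn sgn_zero_iff)
  have "reflection_in_line e0 = reflection_in_line e"
  proof
    fix y
    have "((y \<bullet> e0) / (e0 \<bullet> e0)) *\<^sub>R e0 = ((y \<bullet> e) / (e \<bullet> e)) *\<^sub>R e"
      using e0(1) e(1) by (simp add: e_def sgn_div_norm norm_eq_1 dot_square_norm power2_eq_square field_simps)
    then show "reflection_in_line e0 y = reflection_in_line e y"
      unfolding reflection_in_line_def scaleR_scaleR[symmetric] by simp
  qed
  then have refl: "F (reflection_in_line e y) = F y" for y
    using minkowski_norm_reflection_invariant[OF F e0] by simp
  have sym: "F (a *\<^sub>R e - b *\<^sub>R quarter_turn e) = F (a *\<^sub>R e + b *\<^sub>R quarter_turn e)" for a b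
    using refl[of "a *\<^sub>R e + b *\<^sub>R quarter_turn e"] by (simp add: reflection_in_line_coordinates[OF e(1)])
  obtain g g' where g: "smooth {-1..1} g" "smooth {-1..1} g'" "deriv_on {-1..1} g g'"
      and gpos: "\<And>x. x \<in> {-1..1} \<Longrightarrow> g x > 0" and gtan: "\<And>x. x \<in> {-1..1} \<Longrightarrow> g x - x * g' x > 0"
      and Fg: "\<And>y. y \<noteq> 0 \<Longrightarrow> F y = norm y * g ((y \<bullet> e) / norm y)"
    using profile_function[OF F e(1) sym] by blast
  define h where "h x = x / g x" for x
  define h' where "h' x = (g x - x * g' x) / (g x * g x)" for x
  have gnz: "g x \<noteq> 0" if "x \<in> {-1..1}" for x using gpos[OF that] by simp
  have h: "smooth {-1..1} h" "smooth {-1..1} h'"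
    unfolding h_def h'_def using gnz
    by (auto intro!: smooth_divide smooth_mult smooth_diff smooth_id g)
  have dh: "deriv_on {-1..1} h h'"
    unfolding deriv_on_def
  proof
    fix x :: real assume x: "x \<in> {-1..1}"
    from DERIV_divide[OF DERIV_ident deriv_onD[OF g(3) x] gnz[OF x]]
    show "(h has_real_derivative h' x) (at x within {-1..1})"
      by (simp add: h_def[abs_def] h'_def mult.commute)
  qed
  have h'pos: "h' x > 0" if "x \<in> {-1..1}" for x using gpos[OF that] gtan[OF that] by (simp add: h'_def)
  define a b where "a = h (-1)" and "b = h 1"
  have ab: "a < 0" "b > 0" using gpos[of 1] gpos[of "-1"] by (auto simp: a_def b_def h_def)
  have "-1 < (1::real)" by simp
  from smooth_inverse_function[OF this h(1) dh h(2) h'pos]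
  obtain X v where X: "deriv_on {a..b} X v" "smooth {a..b} v"
      "\<And>x. x \<in> {-1..1} \<Longrightarrow> X (h x) = x" "\<And>x. x \<in> {-1..1} \<Longrightarrow> v (h x) = inverse (h' x)"
      "\<And>s. s \<in> {a..b} \<Longrightarrow> v s > 0" "\<And>x. x \<in> {-1..1} \<Longrightarrow> h x \<in> {a..b}"
    unfolding a_def b_def by blast
  have h0: "h 0 = 0" by (simp add: h_def)
  define m where "m = max (- a) b"
  define d where "d = m + 1"
  have m: "m > 0" "-m \<le> a" "b \<le> m" using ab by (auto simp: m_def)
  have X0: "X 0 = 0" using X(3)[of 0] h0 by simp
  have sub: "{a..b} \<subseteq> {-d..d}" using m by (auto simp: d_def)
  obtain \<phi> \<phi>' where phi: "smooth {-d..d} \<phi>" "deriv_on {-d..d} \<phi> \<phi>'"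
      "\<And>s. s \<in> {-d..d} \<Longrightarrow> \<phi> s > 0" "\<And>s. s \<in> {-d..d} \<Longrightarrow> \<phi> s - s * \<phi>' s > 0"
      "\<And>s. s \<in> {a..b} \<Longrightarrow> s = X s * \<phi> s" "\<phi> 0 = inverse (v 0)"
    by (rule deformation_function_exists[OF _ _ _ X(1,2,5) X0 _ sub]) (use ab m in \<open>auto simp: d_def\<close>)
  have phi_h: "\<phi> (h x) = inverse (g x)" if x: "x \<in> {-1..1}" for x
  proof (cases "x = 0")
    case True
    \<comment> \<open>here \<open>s / X s\<close> is undetermined, and its limit \<open>1 / X' 0 = h' 0\<close> is used instead\<close>
    then show ?thesis using phi(6) X(4)[of 0] h0 by (simp add: h'_def field_simps)
  next
    case False
    have "x / g x = x * \<phi> (h x)" using phi(5)[OF X(6)[OF x]] X(3)[OF x] by (simp add: h_def)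
    then show ?thesis using False by (simp add: divide_inverse)
  qed
  define \<beta> where "\<beta> y = y \<bullet> e" for y
  have x_in: "(y \<bullet> e) / norm y \<in> {-1..1}" if "y \<noteq> 0" for y
    using Cauchy_Schwarz_ineq2[of y e] that e(1) by (auto simp: abs_le_iff divide_le_eq le_divide_eq)
  have s_eq: "\<beta> y / F y = h ((y \<bullet> e) / norm y)" if "y \<noteq> 0" for y
    using that by (simp add: \<beta>_def Fg h_def)
  have def_norm: "deform \<beta> \<phi> F = norm"
  proof
    fix y
    show "deform \<beta> \<phi> F y = norm y"
    proof (cases "y = 0")
      case True then show ?thesis by (simp add: deform_def minkowski_norm_0[OF F])
    next
      case False
      then show ?thesis
        unfolding deform_def s_eq[OF False] phi_h[OF x_in[OF False]]
        using gnz[OF x_in[OF False]] by (simp add: Fg)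
    qed
  qed
  have "form_norm F \<beta> \<le> m"
    unfolding form_norm_def
  proof (rule cSUP_least)
    show "- {0::real^2} \<noteq> {}" using e(2) by auto
    fix y :: "real^2" assume "y \<in> - {0}"
    then have y: "y \<noteq> 0" by simp
    have "\<bar>\<beta> y\<bar> / F y = \<bar>\<beta> y / F y\<bar>" using minkowski_norm_pos[OF F y] by simp
    also have "\<dots> \<le> m" using X(6)[OF x_in[OF y]] m unfolding s_eq[OF y] by auto
    finally show "\<bar>\<beta> y\<bar> / F y \<le> m" .
  qed
  moreover have "linear \<beta>"
    unfolding \<beta>_def by (rule bounded_linear.linear) (rule bounded_linear_inner_left)
  moreover have "\<beta> \<noteq> (\<lambda>y. 0)"
  proof
    assume "\<beta> = (\<lambda>y. 0)"
    then have "e \<bullet> e = 0" unfolding \<beta>_def by meson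
    with e(2) show False by simp
  qed
  moreover have "smooth_on {-d..d} \<phi>" by (rule smooth_imp_smooth_on[OF _ phi(1)]) (use m in \<open>simp add: d_def\<close>)
  moreover have "vector_derivative \<phi> (at s within {-d..d}) = \<phi>' s" if "s \<in> {-d..d}" for s
    using deriv_onD[OF phi(2) that] that m
    by (intro vector_derivative_within_closed_interval)
      (auto simp: has_real_derivative_iff_has_vector_derivative d_def)
  ultimately have "deformation_data F \<beta> d \<phi>"
    using phi(3,4) by (simp add: deformation_data_def d_def)
  moreover have "convex_body norm = cball (0 :: real^2) 1" by (auto simp: convex_body_def)
  ultimately show ?thesis using def_norm by metis
qed

end
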